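(* Let $f\in C([0,\infty),\mathbb{R})$ with $f(0)=0$ satisfy $(f_0)$, and let $0<p<1$. Then for every $k\in\mathbb{N}$ there exists $\lambda_k>0$ such that for every $\lambda\in[-\lambda_k,\lambda_k]$ the problem $$(-\Delta)^s u=\lambda u^p+f(u),\ u>0 \text{ in }\Omega,\qquad u=0 \text{ in }\mathbb{R}^N\setminus\Omega$$ has at least $k$ distinct (nontrivial, nonnegative) weak solutions $u_{1,\lambda},\dots,u_{k,\lambda}\in X_0^s(\Omega)$, and for every $i\in\{1,\dots,k\}$, $$\|u_{i,\lambda}\|_{X_0^s(\Omega)}<\frac1i\quad\text{and}\quad\|u_{i,\lambda}\|_{L^\infty(\Omega)}<\frac1i.$$
   Context: $\Omega\subset\mathbb{R}^N$ ($N\ge2$, $N>2s$) is a bounded smooth domain, $s\in(0,1)$, $(-\Delta)^s$ the fractional Laplacian. $X_0^s(\Omega)=\{u\in H^s(\mathbb{R}^N): u=0 \text{ a.e. in }\mathbb{R}^N\setminus\Omega\}$ with norm $\|u\|_{X_0^s(\Omega)}^2=\int_{\mathbb{R}^{2N}}\frac{|u(x)-u(y)|^2}{|x-y|^{N+2s}}dxdy$. $F(t)=\int_0^tf$. Condition $(f_0)$: $-\infty<\liminf_{t\to0^+}F(t)/t^2\le\limsup_{t\to0^+}F(t)/t^2=+\infty$ and $l_0:=\liminf_{t\to0^+}f(t)/t<0$. Nonlinearities are extended by $0$ for $u\le0$. A weak solution is $u\in X_0^s(\Omega)$ with $\int_{\mathbb{R}^{2N}}\frac{(u(x)-u(y))(\varphi(x)-\varphi(y))}{|x-y|^{N+2s}}dxdy=\lambda\int_\Omega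 u^p\varphi+\int_\Omega f(u)\varphi$ for all $\varphi\in X_0^s(\Omega)$. *)

theory Defs
  imports "HOL-Analysis.Analysis" "HOL-Probability.Essential_Supremum"
begin

type_synonym 'n rfun = "real^'n \<Rightarrow> real"

fun Ck :: "nat \<Rightarrow> 'n::finite rfun \<Rightarrow> bool" where
  "Ck 0 g = continuous_on UNIV g"
| "Ck (Suc k) g = (\<exists>D :: 'n \<Rightarrow> 'n rfun.
      (\<forall>x. (g has_derivative (\<lambda>h. \<Sum>i\<in>UNIV. D i x * h $ i)) (at x)) \<and> (\<forall>i. Ck k (D i)))"

definition smooth_fun :: "'n::finite rfun \<Rightarrow> bool" where
  "smooth_fun g \<longleftrightarrow> (\<forall>k. Ck k g)"

definition bounded_smooth_domain :: "(real^'n::finite) set \<Rightarrow> bool" where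
  "bounded_smooth_domain \<Omega> \<longleftrightarrow> \<Omega> \<noteq> {} \<and> open \<Omega> \<and> connected \<Omega> \<and> bounded \<Omega> \<and>
     (\<exists>\<phi>. smooth_fun \<phi> \<and> \<Omega> = {x. \<phi> x < 0} \<and>
        (\<forall>x. \<phi> x = 0 \<longrightarrow> (\<exists>D. (\<phi> has_derivative D) (at x) \<and> D \<noteq> (\<lambda>_. 0))))"

definition gag :: "real \<Rightarrow> 'n::finite rfun \<Rightarrow> 'n rfun \<Rightarrow> ((real^'n) \<times> (real^'n)) \<Rightarrow> real" where
  "gag s u v = (\<lambda>(x,y). (u x - u y) * (v x - v y) / norm (x - y) powr (real CARD('n) + 2 * s))"

definition X0 :: "real \<Rightarrow> (real^'n::finite) set \<Rightarrow> 'n rfun set" where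
  "X0 s \<Omega> = {u. u \<in> borel_measurable lborel \<and> integrable lborel (\<lambda>x. (u x)\<^sup>2) \<and>
      integrable (lborel \<Otimes>\<^sub>M lborel) (gag s u u) \<and>
      (AE x in lborel. x \<notin> \<Omega> \<longrightarrow> u x = 0)}"

definition X0_norm :: "real \<Rightarrow> 'n::finite rfun \<Rightarrow> real" where
  "X0_norm s u = sqrt (\<integral>z. gag s u u z \<partial>(lborel \<Otimes>\<^sub>M lborel))"

definition Linf_norm :: "(real^'n::finite) set \<Rightarrow> 'n rfun \<Rightarrow> ereal" where
  "Linf_norm \<Omega> u = esssup (restrict_space lborel \<Omega>) (\<lambda>x. ereal \<bar>u x\<bar>)"

text \<open>Weak solution of (-Delta)^s u = lambda u^p + f(u) in Omega, u = 0 outside,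
  with the nonlinearities extended by 0 for u <= 0.\<close>
definition weak_solution ::
  "real \<Rightarrow> (real^'n::finite) set \<Rightarrow> real \<Rightarrow> real \<Rightarrow> (real \<Rightarrow> real) \<Rightarrow> 'n rfun \<Rightarrow> bool" where
  "weak_solution s \<Omega> lam p f u \<longleftrightarrow> u \<in> X0 s \<Omega> \<and>
     (\<forall>\<phi>\<in>X0 s \<Omega>.
        (\<integral>z. gag s u \<phi> z \<partial>(lborel \<Otimes>\<^sub>M lborel)) =
        lam * (LINT x:\<Omega>|lborel. (max (u x) 0) powr p * \<phi> x)
        + (LINT x:\<Omega>|lborel. (if u x \<le> 0 then 0 else f (u x)) * \<phi> x))"

definition primF :: "(real \<Rightarrow> real) \<Rightarrow> real \<Rightarrow> real" where
  "primF f t = integral {0..t} f"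

definition cond_f0 :: "(real \<Rightarrow> real) \<Rightarrow> bool" where
  "cond_f0 f \<longleftrightarrow>
     Liminf (at_right 0) (\<lambda>t. ereal (primF f t / t\<^sup>2)) > -\<infinity> \<and>
     Limsup (at_right 0) (\<lambda>t. ereal (primF f t / t\<^sup>2)) = \<infinity> \<and>
     Liminf (at_right 0) (\<lambda>t. ereal (f t / t)) < 0"

end

theory Submission
  imports Defs
begin

text \<open>
  The energy \<open>J(u) = [u]\<^sup>2/2 - \<integral>\<^sub>\<Omega> G(u)\<close> is submodular, \<open>J(max u v) + J(min u v) \<le> J(u) + J(v)\<close>,
  so on the order interval \<open>0 \<le> u \<le> b\<close> the limit superior of a fast minimizing sequence is a
  minimizer; Fatou's lemma replaces compact embeddings.
  If \<open>\<lambda> b\<^sup>p + f(b) \<le> 0\<close>, clamping to \<open>[0, b]\<close> does not increase the energy of the problem with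
  truncated nonlinearity, so the minimizer is a global one and solves the equation.
  Such \<open>b\<close> with \<open>f(b) < 0\<close> exist arbitrarily close to \<open>0\<close>. For \<open>\<lambda> = 0\<close> the minimal energy on
  \<open>[0, b]\<close> is negative (test with \<open>t w\<close>, where \<open>w\<close> is a bump and \<open>F(t)/t\<^sup>2\<close> is large) and tends to
  \<open>0\<close> with \<open>b\<close>; hence one can choose \<open>b\<^sub>1 > b\<^sub>2 > \<dots>\<close> with separated energy levels, and the
  separation of the first \<open>k\<close> of them survives for small \<open>\<lambda>\<close>.
\<close>

section \<open>The fractional energy\<close>

abbreviation lborel2 :: "((real^'n::finite) \<times> (real^'n)) measure"
  where "lborel2 \<equiv> lborel \<Otimes>\<^sub>M lborel"

text \<open>The argument \<open>G\<close> stands for a primitive of the right-hand side, so that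
  critical points solve the weak equation with nonlinearity \<open>G'\<close>.\<close>

definition energy :: "real \<Rightarrow> (real^'n::finite) set \<Rightarrow> (real \<Rightarrow> real) \<Rightarrow> 'n rfun \<Rightarrow> real" where
  "energy s \<Omega> G u = (\<integral>z. gag s u u z \<partial>lborel2) / 2 - (LINT x:\<Omega>|lborel. G (u x))"

text \<open>The bounds hold at every point, not just almost everywhere, so pointwise suprema, infima
  and limits stay in the class without handling null sets.\<close>

definition X0_between :: "real \<Rightarrow> (real^'n::finite) set \<Rightarrow> real \<Rightarrow> 'n rfun set" where
  "X0_between s \<Omega> b = {u \<in> X0 s \<Omega>. \<forall>x. 0 \<le> u x \<and> u x \<le> b}"

lemma gag_measurable [measurable]:
  fixes u v :: "'n::finite rfun"
  assumes [measurable]: "u \<in> borel_measurable lborel" "v \<in> borel_measurable lborel"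
  shows "gag s u v \<in> borel_measurable lborel2"
  unfolding gag_def by measurable

lemma X0_measurable: "u \<in> X0 s \<Omega> \<Longrightarrow> u \<in> borel_measurable lborel"
  by (simp add: X0_def)

lemma gag_self_nonneg: "0 \<le> gag s u u z"
  by (cases z) (simp add: gag_def)

lemma gag_self_mono:
  assumes "\<And>x y. \<bar>v x - v y\<bar> \<le> \<bar>u x - u y\<bar>"
  shows "gag s v v z \<le> gag s u u z"
proof (cases z)
  case (Pair x y)
  have "(v x - v y) * (v x - v y) \<le> (u x - u y) * (u x - u y)"
    using assms[of x y] by (metis abs_le_square_iff power2_eq_square)
  then show ?thesis unfolding Pair gag_def by (simp add: divide_right_mono)
qed

text \<open>By \<open>|a * c| <= a * a + c * c\<close>, applied to the differences of
  \<open>u\<close> and \<open>v\<close>, the mixed integrand is dominated by the two diagonal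
  ones.\<close>

lemma gag_integrable:
  fixes u v :: "'n::finite rfun"
  assumes "u \<in> X0 s \<Omega>" "v \<in> X0 s \<Omega>"
  shows "integrable lborel2 (gag s u v)"
proof (rule Bochner_Integration.integrable_bound)
  show "integrable lborel2 (\<lambda>z. gag s u u z + gag s v v z)"
    using assms by (auto simp: X0_def)
  show "gag s u v \<in> borel_measurable lborel2"
    using assms by (intro gag_measurable X0_measurable)
  show "AE z in lborel2. norm (gag s u v z) \<le> norm (gag s u u z + gag s v v z)"
  proof (intro AE_I2)
    fix z :: "(real^'n) \<times> (real^'n)"
    obtain x y where z: "z = (x, y)" by (cases z)
    define a c d where "a = u x - u y" and "c = v x - v y"
      and "d = norm (x - y) powr (real CARD('n) + 2 * s)"
    have "\<bar>a * c\<bar> \<le> a * a + c * c"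
      using sum_squares_bound[of "\<bar>a\<bar>" "\<bar>c\<bar>"] abs_ge_zero[of "a * c"]
      unfolding power2_eq_square abs_mult abs_mult_self_eq by linarith
    then have "\<bar>a * c\<bar> / d \<le> (a * a + c * c) / d" by (intro divide_right_mono) (auto simp: d_def)
    moreover have "d \<ge> 0" by (simp add: d_def)
    ultimately show "norm (gag s u v z) \<le> norm (gag s u u z + gag s v v z)"
      by (simp add: z gag_def add_divide_distrib abs_mult flip: a_def c_def d_def)
  qed
qed

text \<open>Expanding the square in the numerator gives the energy along a line, from which the
  first variation is read off. Scaling and negation are the case \<open>u = 0\<close>.\<close>

lemma X0_linear:
  fixes u v :: "'n::finite rfun"
  assumes u: "u \<in> X0 s \<Omega>" and v: "v \<in> X0 s \<Omega>"
  shows "(\<lambda>x. u x + c * v x) \<in> X0 s \<Omega>"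
    and "(\<integral>z. gag s (\<lambda>x. u x + c * v x) (\<lambda>x. u x + c * v x) z \<partial>lborel2)
      = (\<integral>z. gag s u u z \<partial>lborel2) + 2 * c * (\<integral>z. gag s u v z \<partial>lborel2)
        + c\<^sup>2 * (\<integral>z. gag s v v z \<partial>lborel2)"
proof -
  have [measurable]: "u \<in> borel_measurable lborel" "v \<in> borel_measurable lborel"
    using u v by (auto simp: X0_def)
  have eq: "gag s (\<lambda>x. u x + c * v x) (\<lambda>x. u x + c * v x)
      = (\<lambda>z. gag s u u z + 2 * c * gag s u v z + c\<^sup>2 * gag s v v z)"
    by (auto simp: gag_def fun_eq_iff add_divide_distrib[symmetric] algebra_simps power2_eq_square)
  have i: "integrable lborel2 (gag s u u)" "integrable lborel2 (gag s u v)"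
    "integrable lborel2 (gag s v v)"
    using gag_integrable[OF u u] gag_integrable[OF u v] gag_integrable[OF v v] .
  show "(\<integral>z. gag s (\<lambda>x. u x + c * v x) (\<lambda>x. u x + c * v x) z \<partial>lborel2)
      = (\<integral>z. gag s u u z \<partial>lborel2) + 2 * c * (\<integral>z. gag s u v z \<partial>lborel2)
        + c\<^sup>2 * (\<integral>z. gag s v v z \<partial>lborel2)"
    unfolding eq using i by simp
  have "integrable lborel (\<lambda>x. (u x + c * v x)\<^sup>2)"
  proof (rule Bochner_Integration.integrable_bound)
    show "integrable lborel (\<lambda>x. 2 * (u x)\<^sup>2 + 2 * c\<^sup>2 * (v x)\<^sup>2)"
      using u v by (auto simp: X0_def)
    have "(u x + c * v x)\<^sup>2 \<le> 2 * (u x)\<^sup>2 + 2 * c\<^sup>2 * (v x)\<^sup>2" for x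
      using sum_squares_bound[of "u x" "c * v x"] by (simp add: power2_sum power_mult_distrib)
    then show "AE x in lborel. norm ((u x + c * v x)\<^sup>2) \<le> norm (2 * (u x)\<^sup>2 + 2 * c\<^sup>2 * (v x)\<^sup>2)"
      by (intro AE_I2) (smt (verit) real_norm_def zero_le_power2)
  qed measurable
  moreover have "AE x in lborel. x \<notin> \<Omega> \<longrightarrow> u x + c * v x = 0"
    using u v unfolding X0_def by auto
  moreover have "integrable lborel2 (gag s (\<lambda>x. u x + c * v x) (\<lambda>x. u x + c * v x))"
    unfolding eq using i by simp
  ultimately show "(\<lambda>x. u x + c * v x) \<in> X0 s \<Omega>"
    unfolding X0_def by simp
qed

lemma X0_zero: "((\<lambda>_. 0) :: 'n::finite rfun) \<in> X0 s \<Omega>"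
proof -
  have "gag s ((\<lambda>_. 0) :: 'n rfun) (\<lambda>_. 0) = (\<lambda>_. 0)" by (auto simp: gag_def)
  then show ?thesis by (simp add: X0_def)
qed

text \<open>On the finite-measure set \<open>\<Omega>\<close> the bound
  \<open>|t| <= 1 + t^2\<close> turns square integrability into integrability. Test functions thus
  pair with bounded nonlinearities.\<close>

lemma X0_integrable:
  fixes \<Omega> :: "(real^'n::finite) set"
  assumes u: "u \<in> X0 s \<Omega>" and \<Omega>: "open \<Omega>" "bounded \<Omega>"
  shows "integrable lborel u"
proof (rule Bochner_Integration.integrable_bound)
  show "integrable lborel (\<lambda>x. indicator \<Omega> x + (u x)\<^sup>2 :: real)"
    using u \<Omega> emeasure_bounded_finite[OF \<Omega>(2)]
    by (intro Bochner_Integration.integrable_add integrable_real_indicator) (auto simp: X0_def)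
  show "u \<in> borel_measurable lborel" using u by (rule X0_measurable)
  have "AE x in lborel. x \<notin> \<Omega> \<longrightarrow> u x = 0" using u by (simp add: X0_def)
  then show "AE x in lborel. norm (u x) \<le> norm (indicator \<Omega> x + (u x)\<^sup>2 :: real)"
  proof eventually_elim
    fix x assume "x \<notin> \<Omega> \<longrightarrow> u x = 0"
    moreover have "\<bar>u x\<bar> \<le> 1 + (u x)\<^sup>2"
      using sum_squares_bound[of 1 "\<bar>u x\<bar>"] by simp
    ultimately show "norm (u x) \<le> norm (indicator \<Omega> x + (u x)\<^sup>2 :: real)"
      by (cases "x \<in> \<Omega>") auto
  qed
qed

text \<open>Square integrability is automatic for a bounded function that vanishes almost everywhere
  outside a bounded set.\<close>

lemma X0_between_intro:
  fixes \<Omega> :: "(real^'n::finite) set"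
  assumes \<Omega>: "open \<Omega>" "bounded \<Omega>" and [measurable]: "u \<in> borel_measurable lborel"
    and ub: "\<And>x. 0 \<le> u x \<and> u x \<le> b"
    and zero: "AE x in lborel. x \<notin> \<Omega> \<longrightarrow> u x = 0"
    and q: "integrable lborel2 (gag s u u)"
  shows "u \<in> X0_between s \<Omega> b"
proof -
  have "integrable lborel (\<lambda>x. (u x)\<^sup>2)"
  proof (rule Bochner_Integration.integrable_bound)
    show "integrable lborel (\<lambda>x. b\<^sup>2 * indicator \<Omega> x :: real)"
      using \<Omega> by (auto intro!: emeasure_bounded_finite)
    show "AE x in lborel. norm ((u x)\<^sup>2) \<le> norm (b\<^sup>2 * indicator \<Omega> x :: real)"
      using zero by eventually_elim (use ub in \<open>auto simp: indicator_def intro!: power_mono\<close>)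
  qed measurable
  then show ?thesis unfolding X0_between_def X0_def using zero q ub by simp
qed

lemma set_integrable_bounded:
  fixes \<Omega> :: "(real^'n::finite) set" and g :: "real^'n \<Rightarrow> real"
  assumes \<Omega>: "open \<Omega>" "bounded \<Omega>" and [measurable]: "g \<in> borel_measurable lborel"
    and b: "\<And>x. x \<in> \<Omega> \<Longrightarrow> \<bar>g x\<bar> \<le> B"
  shows "set_integrable lborel \<Omega> g"
  unfolding set_integrable_def
proof -
  have [measurable]: "\<Omega> \<in> sets borel" using \<Omega> by simp
  show "integrable lborel (\<lambda>x. indicat_real \<Omega> x *\<^sub>R g x)"
  proof (rule Bochner_Integration.integrable_bound)
    show "integrable lborel (\<lambda>x. B * indicator \<Omega> x :: real)"
      using \<Omega> by (auto intro!: emeasure_bounded_finite)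
    show "(\<lambda>x. indicat_real \<Omega> x *\<^sub>R g x) \<in> borel_measurable lborel"
      by measurable
    show "AE x in lborel. norm (indicat_real \<Omega> x *\<^sub>R g x) \<le> norm (B * indicator \<Omega> x :: real)"
      using b by (intro AE_I2) (auto simp: indicator_def, force)
  qed
qed

text \<open>Solutions are to be distinguished up to null sets; since the energy sees only the
  almost-everywhere class, different energies suffice.\<close>

lemma energy_cong_AE:
  fixes u v :: "'n::finite rfun"
  assumes [measurable]: "u \<in> borel_measurable lborel" "v \<in> borel_measurable lborel"
      "G \<in> borel_measurable borel" "\<Omega> \<in> sets borel"
    and ae: "AE x in lborel. u x = v x"
  shows "energy s \<Omega> G u = energy s \<Omega> G v"
proof -
  \<comment> \<open>Agreement in both coordinates holds almost everywhere on the product because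
    almost every slice has a null exceptional set.\<close>
  have "AE z in lborel2. u (fst z) = v (fst z) \<and> u (snd z) = v (snd z)"
  proof (rule lborel_pair.AE_pair_measure)
    show "AE x in lborel. AE y in lborel.
        u (fst (x, y)) = v (fst (x, y)) \<and> u (snd (x, y)) = v (snd (x, y))"
      using ae by eventually_elim (use ae in simp)
  qed measurable
  then have "(\<integral>z. gag s u u z \<partial>lborel2) = (\<integral>z. gag s v v z \<partial>lborel2)"
    by (intro integral_cong_AE) (auto simp: gag_def split: prod.split)
  moreover have "(LINT x:\<Omega>|lborel. G (u x)) = (LINT x:\<Omega>|lborel. G (v x))"
    unfolding set_lebesgue_integral_def
    using ae by (intro integral_cong_AE) auto
  ultimately show ?thesis by (simp add: energy_def)
qed

section \<open>Minimization on order intervals\<close>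

lemma continuous_bounded_interval:
  fixes G :: "real \<Rightarrow> real"
  assumes "continuous_on UNIV G"
  obtains B where "0 \<le> B" "\<And>t. 0 \<le> t \<Longrightarrow> t \<le> b \<Longrightarrow> \<bar>G t\<bar> \<le> B"
proof -
  have "compact (G ` {0..b})"
    using assms by (intro compact_continuous_image) (auto intro: continuous_on_subset)
  then obtain B where "\<forall>y\<in>G ` {0..b}. \<bar>y\<bar> \<le> B"
    unfolding bounded_iff by (metis bounded_iff compact_imp_bounded real_norm_def)
  then have "\<And>t. 0 \<le> t \<Longrightarrow> t \<le> b \<Longrightarrow> \<bar>G t\<bar> \<le> max B 0"
    by (meson atLeastAtMost_iff image_eqI le_max_iff_disj)
  then show thesis using that[of "max B 0"] by auto
qed

lemma set_integrable_comp_between: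
  fixes u :: "'n::finite rfun" and G :: "real \<Rightarrow> real"
  assumes \<Omega>: "open \<Omega>" "bounded \<Omega>" and G: "continuous_on UNIV G"
    and u: "u \<in> X0_between s \<Omega> b"
  shows "set_integrable lborel \<Omega> (\<lambda>x. G (u x))"
proof -
  obtain B where "0 \<le> B" "\<And>t. 0 \<le> t \<Longrightarrow> t \<le> b \<Longrightarrow> \<bar>G t\<bar> \<le> B"
    using continuous_bounded_interval[OF G, of b] by blast
  moreover have [measurable]: "G \<in> borel_measurable borel"
    using G by (simp add: borel_measurable_continuous_onI)
  have [measurable]: "u \<in> borel_measurable lborel" using u by (auto simp: X0_between_def X0_def)
  have "(\<lambda>x. G (u x)) \<in> borel_measurable lborel" by measurable
  ultimately show ?thesis using u by (intro set_integrable_bounded[OF \<Omega>]) (auto simp: X0_between_def)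
qed

text \<open>Pointwise convergence suffices: Fatou handles the Gagliardo integral, and dominated
  convergence the potential, whose integrand is bounded on \<open>{0..b}\<close>. The energy bounds
  also make the Gagliardo integral of the limit finite.\<close>

lemma energy_lower_semicontinuous:
  fixes v :: "nat \<Rightarrow> 'n::finite rfun"
  assumes \<Omega>: "open \<Omega>" "bounded \<Omega>" and G: "continuous_on UNIV G"
    and v: "\<And>k. v k \<in> X0_between s \<Omega> b"
    and lim: "\<And>x. (\<lambda>k. v k x) \<longlonglongrightarrow> w x"
    and c: "\<And>k. energy s \<Omega> G (v k) \<le> c k" "c \<longlonglongrightarrow> c0"
  shows "w \<in> X0_between s \<Omega> b" and "energy s \<Omega> G w \<le> c0"
proof -
  have vm [measurable]: "v k \<in> borel_measurable lborel" for k
    using v[of k] by (auto simp: X0_between_def X0_def)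
  have wm [measurable]: "w \<in> borel_measurable lborel"
    by (rule borel_measurable_LIMSEQ_real[OF lim vm])
  have Gm [measurable]: "G \<in> borel_measurable borel"
    using G by (simp add: borel_measurable_continuous_onI)
  have [measurable]: "\<Omega> \<in> sets borel" using \<Omega> by simp
  have vb: "0 \<le> v k x \<and> v k x \<le> b" for k x using v[of k] by (auto simp: X0_between_def)
  have wb: "0 \<le> w x \<and> w x \<le> b" for x
    using vb by (auto intro!: LIMSEQ_le_const[OF lim] LIMSEQ_le_const2[OF lim])
  have "\<forall>k. AE x in lborel. x \<notin> \<Omega> \<longrightarrow> v k x = 0"
    using v by (auto simp: X0_between_def X0_def)
  then have "AE x in lborel. \<forall>k. x \<notin> \<Omega> \<longrightarrow> v k x = 0"
    by (rule iffD2[OF AE_all_countable])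
  then have w0: "AE x in lborel. x \<notin> \<Omega> \<longrightarrow> w x = 0"
  proof eventually_elim
    case (elim x)
    show ?case
    proof
      assume "x \<notin> \<Omega>"
      with elim have "(\<lambda>k. v k x) = (\<lambda>_. 0)" by auto
      then show "w x = 0" using LIMSEQ_unique[OF lim[of x]] by simp
    qed
  qed
  obtain B where B: "0 \<le> B" "\<And>t. 0 \<le> t \<Longrightarrow> t \<le> b \<Longrightarrow> \<bar>G t\<bar> \<le> B"
    using continuous_bounded_interval[OF G, of b] by blast
  define g where "g k = (LINT x:\<Omega>|lborel. G (v k x))" for k
  define g0 where "g0 = (LINT x:\<Omega>|lborel. G (w x))"
  have glim: "g \<longlonglongrightarrow> g0"
    unfolding g_def g0_def set_lebesgue_integral_def
  proof (rule integral_dominated_convergence[where w = "\<lambda>x. B * indicator \<Omega> x"])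
    show "integrable lborel (\<lambda>x. B * indicat_real \<Omega> x)"
      using \<Omega> emeasure_bounded_finite[OF \<Omega>(2)] by simp
    show "AE x in lborel. (\<lambda>k. indicat_real \<Omega> x *\<^sub>R G (v k x)) \<longlonglongrightarrow> indicat_real \<Omega> x *\<^sub>R G (w x)"
      using lim G
      by (auto intro!: tendsto_intros isCont_tendsto_compose[of _ G] simp: continuous_on_eq_continuous_at)
    show "AE x in lborel. norm (indicat_real \<Omega> x *\<^sub>R G (v k x)) \<le> B * indicat_real \<Omega> x" for k
      using B vb by (auto simp: indicator_def)
  qed measurable
  define q where "q k = (\<integral>z. gag s (v k) (v k) z \<partial>lborel2)" for k
  \<comment> \<open>The energy bound gives \<open>q k <= r k\<close>, and \<open>r\<close> converges
    although \<open>q\<close> need not.\<close>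
  define r where "r k = 2 * (c k + g k)" for k
  have qr: "0 \<le> q k" "q k \<le> r k" for k
    using c(1)[of k] by (auto simp: r_def q_def g_def energy_def gag_self_nonneg)
  have rlim: "r \<longlonglongrightarrow> 2 * (c0 + g0)" unfolding r_def by (intro tendsto_intros c glim)
  have R0: "0 \<le> 2 * (c0 + g0)"
    by (rule LIMSEQ_le_const[OF rlim]) (use qr order_trans in blast)
  have "(\<integral>\<^sup>+z. ennreal (gag s w w z) \<partial>lborel2)
      = (\<integral>\<^sup>+z. liminf (\<lambda>k. ennreal (gag s (v k) (v k) z)) \<partial>lborel2)"
  proof (intro nn_integral_cong)
    fix z :: "(real^'n) \<times> (real^'n)"
    obtain x y where z: "z = (x, y)" by (cases z)
    have "(\<lambda>k. gag s (v k) (v k) z) \<longlonglongrightarrow> gag s w w z"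
    \<comment> \<open>Off the diagonal the denominator is a nonzero constant; on it every numerator
      is \<open>0\<close>.\<close>
    proof (cases "x = y")
      case False
      then show ?thesis unfolding z gag_def by (auto intro!: tendsto_intros lim)
    qed (simp add: z gag_def)
    then show "ennreal (gag s w w z) = liminf (\<lambda>k. ennreal (gag s (v k) (v k) z))"
      by (intro lim_imp_Liminf[symmetric] tendsto_ennrealI) auto
  qed
  also have "\<dots> \<le> liminf (\<lambda>k. \<integral>\<^sup>+z. ennreal (gag s (v k) (v k) z) \<partial>lborel2)"
    by (intro nn_integral_liminf) measurable
  also have "\<dots> \<le> liminf (\<lambda>k. ennreal (r k))"
  proof (intro Liminf_mono always_eventually allI)
    fix k
    have "(\<integral>\<^sup>+z. ennreal (gag s (v k) (v k) z) \<partial>lborel2) = ennreal (q k)"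
      unfolding q_def using v[of k]
      by (intro nn_integral_eq_integral) (auto simp: X0_between_def X0_def gag_self_nonneg)
    then show "(\<integral>\<^sup>+z. ennreal (gag s (v k) (v k) z) \<partial>lborel2) \<le> ennreal (r k)"
      using qr by (simp add: ennreal_leI)
  qed
  also have "\<dots> = ennreal (2 * (c0 + g0))"
    by (intro lim_imp_Liminf tendsto_ennrealI rlim) simp
  finally have le: "(\<integral>\<^sup>+z. ennreal (gag s w w z) \<partial>lborel2) \<le> ennreal (2 * (c0 + g0))" .
  have int: "integrable lborel2 (gag s w w)"
  proof (rule integrableI_bounded)
    show "gag s w w \<in> borel_measurable lborel2" by (rule gag_measurable[OF wm wm])
    show "(\<integral>\<^sup>+z. ennreal (norm (gag s w w z)) \<partial>lborel2) < \<infinity>"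
      using le by (simp add: gag_self_nonneg) (meson ennreal_less_top le_less_trans)
  qed
  show "w \<in> X0_between s \<Omega> b"
    by (rule X0_between_intro[OF \<Omega> wm wb w0 int])
  have "ennreal (\<integral>z. gag s w w z \<partial>lborel2) \<le> ennreal (2 * (c0 + g0))"
    using le nn_integral_eq_integral[OF int] by (simp add: gag_self_nonneg)
  then have "(\<integral>z. gag s w w z \<partial>lborel2) \<le> 2 * (c0 + g0)" using R0 by simp
  then show "energy s \<Omega> G w \<le> c0" by (simp add: energy_def g0_def)
qed

text \<open>If both pairs are ordered alike, the two sides agree. If they cross, the right side
  exceeds the left by twice a product of two nonnegative differences.\<close>

lemma max_min_square_le:
  fixes a b c d :: real
  shows "(max a b - max c d) * (max a b - max c d) + (min a b - min c d) * (min a b - min c d)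
    \<le> (a - c) * (a - c) + (b - d) * (b - d)"
proof -
  consider "a \<le> b" "c \<le> d" | "b \<le> a" "d \<le> c" | "a \<le> b" "d \<le> c" | "b \<le> a" "c \<le> d" by linarith
  then show ?thesis
  proof cases
    case 3
    then have "0 \<le> (b - a) * (c - d)" by simp
    then show ?thesis using 3 by (simp add: algebra_simps max_def min_def)
  next
    case 4
    then have "0 \<le> (a - b) * (d - c)" by simp
    then show ?thesis using 4 by (simp add: algebra_simps max_def min_def)
  qed (auto simp: max_def min_def)
qed

text \<open>The Gagliardo part is \<open>max_min_square_le\<close> integrated. The potential parts
  are equal, since at each point the maximum and minimum are just \<open>u x\<close> and
  \<open>v x\<close> in some order.\<close>

lemma energy_submodular:
  fixes u v :: "'n::finite rfun" and G :: "real \<Rightarrow> real"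
  assumes \<Omega>: "open \<Omega>" "bounded \<Omega>" and G: "continuous_on UNIV G"
    and u: "u \<in> X0_between s \<Omega> b" and v: "v \<in> X0_between s \<Omega> b"
  defines "M \<equiv> \<lambda>x. max (u x) (v x)" and "m \<equiv> \<lambda>x. min (u x) (v x)"
  shows "M \<in> X0_between s \<Omega> b" "m \<in> X0_between s \<Omega> b"
    and "energy s \<Omega> G M + energy s \<Omega> G m \<le> energy s \<Omega> G u + energy s \<Omega> G v"
proof -
  have [measurable]: "u \<in> borel_measurable lborel" "v \<in> borel_measurable lborel"
    using u v by (auto simp: X0_between_def X0_def)
  have Mm [measurable]: "M \<in> borel_measurable lborel" "m \<in> borel_measurable lborel"
    unfolding M_def m_def by measurable
  have bd: "0 \<le> M x \<and> M x \<le> b" "0 \<le> m x \<and> m x \<le> b" for x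
    using u v by (auto simp: X0_between_def M_def m_def max_def min_def)
  have zu: "AE x in lborel. x \<notin> \<Omega> \<longrightarrow> u x = 0" "AE x in lborel. x \<notin> \<Omega> \<longrightarrow> v x = 0"
    using u v by (auto simp: X0_between_def X0_def)
  then have z: "AE x in lborel. x \<notin> \<Omega> \<longrightarrow> M x = 0" "AE x in lborel. x \<notin> \<Omega> \<longrightarrow> m x = 0"
    unfolding M_def m_def by auto
  have iu: "integrable lborel2 (gag s u u)" "integrable lborel2 (gag s v v)"
    using u v by (auto simp: X0_between_def X0_def)
  have le: "gag s M M z + gag s m m z \<le> gag s u u z + gag s v v z" for z
    unfolding gag_def M_def m_def
    using max_min_square_le
    by (auto split: prod.split simp: add_divide_distrib[symmetric] intro!: divide_right_mono)
  \<comment> \<open>Each summand alone is dominated too, which yields the integrability needed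
    before integrating the inequality.\<close>
  have le': "gag s M M z \<le> gag s u u z + gag s v v z" "gag s m m z \<le> gag s u u z + gag s v v z" for z
    using le[of z] gag_self_nonneg[of s M z] gag_self_nonneg[of s m z] by linarith+
  have i: "integrable lborel2 (gag s M M)" "integrable lborel2 (gag s m m)"
    by (rule Bochner_Integration.integrable_bound[OF Bochner_Integration.integrable_add[OF iu]],
        use le' in \<open>auto intro!: gag_measurable AE_I2 simp: gag_self_nonneg Mm\<close>)+
  show X: "M \<in> X0_between s \<Omega> b" "m \<in> X0_between s \<Omega> b"
    by (intro X0_between_intro \<Omega> Mm bd z i)+
  have q: "(\<integral>z. gag s M M z \<partial>lborel2) + (\<integral>z. gag s m m z \<partial>lborel2)
     \<le> (\<integral>z. gag s u u z \<partial>lborel2) + (\<integral>z. gag s v v z \<partial>lborel2)"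
    unfolding Bochner_Integration.integral_add[OF iu, symmetric]
      Bochner_Integration.integral_add[OF i, symmetric]
    by (intro integral_mono le Bochner_Integration.integrable_add iu i)
  note si = set_integrable_comp_between[OF \<Omega> G]
  have "(LINT x:\<Omega>|lborel. G (M x)) + (LINT x:\<Omega>|lborel. G (m x))
     = (LINT x:\<Omega>|lborel. G (M x) + G (m x))"
    using si[OF X(1)] si[OF X(2)] by (simp add: set_integral_add(2))
  also have "(\<lambda>x. G (M x) + G (m x)) = (\<lambda>x. G (u x) + G (v x))"
    by (auto simp: M_def m_def max_def min_def)
  also have "(LINT x:\<Omega>|lborel. G (u x) + G (v x))
     = (LINT x:\<Omega>|lborel. G (u x)) + (LINT x:\<Omega>|lborel. G (v x))"
    using si[OF u] si[OF v] by (simp add: set_integral_add(2))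
  finally show "energy s \<Omega> G M + energy s \<Omega> G m \<le> energy s \<Omega> G u + energy s \<Omega> G v"
    using q by (simp add: energy_def)
qed


text \<open>A minimizing sequence with geometric energy excess is replaced by two monotone limits,
  increasing in \<open>k\<close> and then decreasing in \<open>n\<close>. These converge pointwise,
  so \<open>energy_lower_semicontinuous\<close> applies to each.\<close>

lemma energy_minimizer_exists:
  fixes \<Omega> :: "(real^'n::finite) set" and G :: "real \<Rightarrow> real"
  assumes \<Omega>: "open \<Omega>" "bounded \<Omega>" and G: "continuous_on UNIV G" and b: "0 \<le> b"
  obtains u where "u \<in> X0_between s \<Omega> b"
    "\<And>v. v \<in> X0_between s \<Omega> b \<Longrightarrow> energy s \<Omega> G u \<le> energy s \<Omega> G v"
proof -
  define W :: "'n rfun set" where "W = X0_between s \<Omega> b"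
  define J where "J = energy s \<Omega> G"
  obtain B where B: "0 \<le> B" "\<And>t. 0 \<le> t \<Longrightarrow> t \<le> b \<Longrightarrow> \<bar>G t\<bar> \<le> B"
    using continuous_bounded_interval[OF G, of b] by blast
  \<comment> \<open>The Gagliardo part is nonnegative and \<open>G\<close> is bounded on
    \<open>{0..b}\<close>, so the infimum is finite.\<close>
  have lower: "- (LINT x:\<Omega>|lborel. B) \<le> J v" if v: "v \<in> W" for v
  proof -
    have "(LINT x:\<Omega>|lborel. G (v x)) \<le> (LINT x:\<Omega>|lborel. B)"
    proof (rule set_integral_mono)
      show "set_integrable lborel \<Omega> (\<lambda>x. G (v x))"
        using v unfolding W_def by (rule set_integrable_comp_between[OF \<Omega> G])
      show "set_integrable lborel \<Omega> (\<lambda>x. B)"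
        using B by (intro set_integrable_bounded[OF \<Omega>]) auto
      show "G (v x) \<le> B" for x
        using B(2)[of "v x"] v by (auto simp: W_def X0_between_def)
    qed
    moreover have "0 \<le> (\<integral>z. gag s v v z \<partial>lborel2)" by (simp add: gag_self_nonneg)
    ultimately show ?thesis by (simp add: J_def energy_def)
  qed
  have ne: "W \<noteq> {}" using b X0_zero by (auto simp: W_def X0_between_def)
  have bdd: "bdd_below (J ` W)" using lower by (intro bdd_belowI2)
  define m where "m = Inf (J ` W)"
  have m: "m \<le> J v" if "v \<in> W" for v unfolding m_def using bdd that by (rule cInf_lower[OF imageI, rotated])
  have "\<exists>v\<in>W. J v < m + (1/2)^n" for n :: nat
    using cInf_lessD[of "J ` W" "m + (1/2)^n"] ne by (auto simp: m_def)
  then obtain u where u: "\<And>n. u n \<in> W" "\<And>n. J (u n) < m + (1/2)^n" by metis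
  \<comment> \<open>\<open>w = limsup u\<close> is reached by monotone limits: submodularity bounds the energy excess of the
    running maxima by the sum of the individual excesses.\<close>
  define M where "M n k x = Max ((\<lambda>j. u j x) ` {n..n+k})" for n k x
  have M0: "M n 0 = u n" for n by (simp add: M_def fun_eq_iff)
  have MS: "M n (Suc k) = (\<lambda>x. max (M n k x) (u (n + Suc k) x))" for n k
  proof
    fix x
    have "{n..n + Suc k} = insert (n + Suc k) {n..n+k}" by auto
    then show "M n (Suc k) x = max (M n k x) (u (n + Suc k) x)"
      unfolding M_def by (simp add: max.commute)
  qed
  \<comment> \<open>The added term is the geometric sum of \<open>(1/2)^j\<close> for
    \<open>j\<close> from \<open>n\<close> to \<open>n + k\<close>, the total excess of the
    functions entering the maximum.\<close>
  have MW: "M n k \<in> W \<and> J (M n k) \<le> m + 2 * (1/2)^n - (1/2)^(n+k)" for n k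
  proof (induction k)
    case 0
    show ?case using u[of n] by (simp add: M0)
  next
    case (Suc k)
    note S = energy_submodular[OF \<Omega> G, of "M n k" s b "u (n + Suc k)"]
    have in': "M n k \<in> X0_between s \<Omega> b" "u (n + Suc k) \<in> X0_between s \<Omega> b"
      using Suc u(1) by (auto simp: W_def)
    have "M n (Suc k) \<in> W" using S(1)[OF in'] by (simp add: MS W_def)
    \<comment> \<open>The minimum is admissible, so its energy is at least \<open>m\<close> and may
      be replaced by \<open>m\<close> in the submodular inequality.\<close>
    moreover have "J (M n (Suc k)) + m \<le> J (M n k) + J (u (n + Suc k))"
      using S(3)[OF in'] m S(2)[OF in'] by (simp add: MS W_def J_def) (smt (verit))
    ultimately show ?case using Suc u(2)[of "n + Suc k"] by simp
  qed
  have Mb: "0 \<le> M n k x" "M n k x \<le> b" for n k x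
    using MW[of n k] by (auto simp: W_def X0_between_def)
  define V where "V n x = (SUP k. M n k x)" for n x
  have Minc: "incseq (\<lambda>k. M n k x)" for n x
    by (rule incseq_SucI) (simp add: MS)
  have bddM: "bdd_above (range (\<lambda>k. M n k x))" for n x using Mb by (intro bdd_aboveI2)
  have Mlim: "(\<lambda>k. M n k x) \<longlonglongrightarrow> V n x" for n x
    unfolding V_def by (rule LIMSEQ_incseq_SUP[OF bddM Minc])
  have Vprop: "V n \<in> W" "J (V n) \<le> m + 2 * (1/2)^n" for n
  proof -
    have c: "energy s \<Omega> G (M n k) \<le> m + 2 * (1/2)^n" for k
      using MW[of n k] by (simp add: J_def) (smt (verit) zero_le_power zero_le_divide_1_iff)
    have "M n k \<in> X0_between s \<Omega> b" for k using MW by (simp add: W_def)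
    from energy_lower_semicontinuous[OF \<Omega> G this Mlim c tendsto_const]
    show "V n \<in> W" "J (V n) \<le> m + 2 * (1/2)^n" by (simp_all add: W_def J_def)
  qed
  have Vdec: "decseq (\<lambda>n. V n x)" for x
  proof (rule decseq_SucI)
    fix n
    show "V (Suc n) x \<le> V n x"
      unfolding V_def
    proof (rule cSUP_mono)
      fix k :: nat
      \<comment> \<open>Both index ranges end at \<open>n + Suc k\<close>; the right one also
        contains \<open>n\<close>.\<close>
      have "M (Suc n) k x \<le> M n (Suc k) x"
        unfolding M_def by (intro Max_mono) auto
      then show "\<exists>m\<in>UNIV. M (Suc n) k x \<le> M n m x" by blast
    qed (use bddM in auto)
  qed
  have Vb: "0 \<le> V n x" "V n x \<le> b" for n x
    using Vprop(1)[of n] by (auto simp: W_def X0_between_def)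
  define w where "w x = (INF n. V n x)" for x
  have Vlim: "(\<lambda>n. V n x) \<longlonglongrightarrow> w x" for x
    unfolding w_def using Vb by (intro LIMSEQ_decseq_INF Vdec bdd_belowI2)
  have "(\<lambda>n. m + 2 * (1/2)^n) \<longlonglongrightarrow> m + 2 * 0"
    by (intro tendsto_intros LIMSEQ_realpow_zero) auto
  then have clim: "(\<lambda>n. m + 2 * (1/2)^n) \<longlonglongrightarrow> m" by simp
  have "V n \<in> X0_between s \<Omega> b" "energy s \<Omega> G (V n) \<le> m + 2 * (1/2)^n" for n
    using Vprop by (simp_all add: W_def J_def)
  from energy_lower_semicontinuous[OF \<Omega> G this(1) Vlim this(2) clim]
  have "w \<in> W" "J w \<le> m" by (simp_all add: W_def J_def)
  then show thesis using that[of w] m by (force simp: W_def J_def)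
qed

section \<open>The Euler--Lagrange equation\<close>

lemma lipschitz_of_bounded_derivative:
  fixes G h :: "real \<Rightarrow> real"
  assumes "\<And>t. (G has_real_derivative h t) (at t)" "\<And>t. \<bar>h t\<bar> \<le> K"
  shows "\<bar>G a - G b\<bar> \<le> K * \<bar>a - b\<bar>"
  using field_differentiable_bound[of UNIV G h K b a] assms
  by (simp add: abs_minus_commute)

lemma set_integrable_comp_X0:
  fixes \<Omega> :: "(real^'n::finite) set" and G :: "real \<Rightarrow> real"
  assumes \<Omega>: "open \<Omega>" "bounded \<Omega>"
    and G: "continuous_on UNIV G" "\<And>t. \<bar>G t\<bar> \<le> K * \<bar>t\<bar>" and v: "v \<in> X0 s \<Omega>"
  shows "set_integrable lborel \<Omega> (\<lambda>x. G (v x))"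
proof -
  have [measurable]: "G \<in> borel_measurable borel" "\<Omega> \<in> sets borel" "v \<in> borel_measurable lborel"
    using G \<Omega> v by (simp_all add: borel_measurable_continuous_onI X0_def)
  show ?thesis
    unfolding set_integrable_def
  proof (rule Bochner_Integration.integrable_bound)
    show "integrable lborel (\<lambda>x. K * v x)" using X0_integrable[OF v \<Omega>] by simp
    have "\<bar>G t\<bar> \<le> \<bar>K\<bar> * \<bar>t\<bar>" for t
      using G(2)[of t] mult_right_mono[OF abs_ge_self[of K], of "\<bar>t\<bar>"] by linarith
    then show "AE x in lborel. norm (indicat_real \<Omega> x *\<^sub>R G (v x)) \<le> norm (K * v x)"
      by (auto simp: indicator_def abs_mult)
  qed measurable
qed

text \<open>Clamping is 1-Lipschitz, which lowers the Gagliardo integrand, and moves values outside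
  \<open>{0..b}\<close> to an endpoint where \<open>G\<close> is no smaller. Hence minimizing over
  the order interval is minimizing over \<open>X0\<close>.\<close>

lemma energy_clamp_le:
  fixes v :: "'n::finite rfun" and G :: "real \<Rightarrow> real"
  assumes \<Omega>: "open \<Omega>" "bounded \<Omega>" and b: "0 \<le> b"
    and G: "continuous_on UNIV G" "\<And>t. \<bar>G t\<bar> \<le> K * \<bar>t\<bar>"
      "\<And>t. t \<le> 0 \<Longrightarrow> G t \<le> G 0" "\<And>t. b \<le> t \<Longrightarrow> G t \<le> G b"
    and v: "v \<in> X0 s \<Omega>"
  defines "w \<equiv> \<lambda>x. max 0 (min b (v x))"
  shows "w \<in> X0_between s \<Omega> b" and "energy s \<Omega> G w \<le> energy s \<Omega> G v"
proof -
  have [measurable]: "v \<in> borel_measurable lborel" using v by (simp add: X0_def)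
  have wm [measurable]: "w \<in> borel_measurable lborel" unfolding w_def by measurable
  have zv: "AE x in lborel. x \<notin> \<Omega> \<longrightarrow> v x = 0" and iv: "integrable lborel2 (gag s v v)"
    using v by (auto simp: X0_def)
  have z: "AE x in lborel. x \<notin> \<Omega> \<longrightarrow> w x = 0"
    using zv by eventually_elim (use b in \<open>auto simp: w_def\<close>)
  have le: "gag s w w z \<le> gag s v v z" for z
    by (rule gag_self_mono) (auto simp: w_def)
  have iw: "integrable lborel2 (gag s w w)"
    by (rule Bochner_Integration.integrable_bound[OF iv])
      (use le in \<open>auto intro!: gag_measurable AE_I2 simp: gag_self_nonneg wm\<close>)
  show W: "w \<in> X0_between s \<Omega> b"
    by (rule X0_between_intro[OF \<Omega> wm _ z iw]) (use b in \<open>auto simp: w_def\<close>)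
  have "(\<integral>z. gag s w w z \<partial>lborel2) \<le> (\<integral>z. gag s v v z \<partial>lborel2)"
    by (intro integral_mono iv iw le)
  moreover have "(LINT x:\<Omega>|lborel. G (v x)) \<le> (LINT x:\<Omega>|lborel. G (w x))"
  proof (rule set_integral_mono)
    show "set_integrable lborel \<Omega> (\<lambda>x. G (v x))"
      by (rule set_integrable_comp_X0[OF \<Omega> G(1,2) v])
    show "set_integrable lborel \<Omega> (\<lambda>x. G (w x))"
      by (rule set_integrable_comp_between[OF \<Omega> G(1) W])
    show "G (v x) \<le> G (w x)" for x
      using G(3)[of "v x"] G(4)[of "v x"] b
      by (cases "v x \<le> 0"; cases "v x \<le> b") (auto simp: w_def)
  qed
  ultimately show "energy s \<Omega> G w \<le> energy s \<Omega> G v" by (simp add: energy_def)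
qed

text \<open>Compare \<open>u\<close> with \<open>u + e n * \<phi>\<close> for positive
  \<open>e n\<close> tending to \<open>0\<close> and divide by \<open>e n\<close>. The difference
  quotients of \<open>G\<close> are dominated by \<open>K * |\<phi>|\<close>.\<close>

lemma minimizer_variational_inequality:
  fixes u \<phi> :: "'n::finite rfun" and G h :: "real \<Rightarrow> real"
  assumes \<Omega>: "open \<Omega>" "bounded \<Omega>"
    and G: "\<And>t. (G has_real_derivative h t) (at t)" "G 0 = 0"
    and h: "continuous_on UNIV h" "\<And>t. \<bar>h t\<bar> \<le> K"
    and u: "u \<in> X0 s \<Omega>" and min: "\<And>v. v \<in> X0 s \<Omega> \<Longrightarrow> energy s \<Omega> G u \<le> energy s \<Omega> G v"
    and \<phi>: "\<phi> \<in> X0 s \<Omega>"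
  shows "(LINT x:\<Omega>|lborel. h (u x) * \<phi> x) \<le> (\<integral>z. gag s u \<phi> z \<partial>lborel2)"
proof -
  have Gc: "continuous_on UNIV G"
    using G(1) by (meson DERIV_isCont continuous_at_imp_continuous_on)
  note lip = lipschitz_of_bounded_derivative[OF G(1) h(2)]
  have Gb: "\<bar>G t\<bar> \<le> K * \<bar>t\<bar>" for t using lip[of t 0] G(2) by simp
  have [measurable]: "G \<in> borel_measurable borel" "h \<in> borel_measurable borel" "\<Omega> \<in> sets borel"
      "u \<in> borel_measurable lborel" "\<phi> \<in> borel_measurable lborel"
    using Gc \<Omega> u \<phi> h by (simp_all add: borel_measurable_continuous_onI X0_def)
  define e where "e n = inverse (real (Suc n))" for n
  have e: "0 < e n" "e n \<noteq> 0" for n by (auto simp: e_def)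
  have e0: "e \<longlonglongrightarrow> 0" unfolding e_def by (rule LIMSEQ_inverse_real_of_nat)
  define D where "D n x = (G (u x + e n * \<phi> x) - G (u x)) / e n" for n x
  define q where "q = (\<integral>z. gag s \<phi> \<phi> z \<partial>lborel2)"
  define A where "A = (\<integral>z. gag s u \<phi> z \<partial>lborel2)"
  \<comment> \<open>Minimality and the quadratic expansion of the Gagliardo part; after division its
    second-order term is \<open>e n / 2 * q\<close>, which tends to \<open>0\<close>.\<close>
  have le: "(LINT x:\<Omega>|lborel. D n x) \<le> A + e n / 2 * q" for n
  proof -
    note X = X0_linear[OF u \<phi>, of "e n"]
    have si: "set_integrable lborel \<Omega> (\<lambda>x. G (u x + e n * \<phi> x))"
      "set_integrable lborel \<Omega> (\<lambda>x. G (u x))"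
      using set_integrable_comp_X0[OF \<Omega> Gc Gb X(1)] set_integrable_comp_X0[OF \<Omega> Gc Gb u] .
    have "(LINT x:\<Omega>|lborel. D n x) * e n = (LINT x:\<Omega>|lborel. G (u x + e n * \<phi> x) - G (u x))"
      unfolding set_integral_mult_left[symmetric] D_def using e by simp
    also have "\<dots> = (LINT x:\<Omega>|lborel. G (u x + e n * \<phi> x)) - (LINT x:\<Omega>|lborel. G (u x))"
      using si by simp
    also have "\<dots> \<le> e n * A + (e n)\<^sup>2 * q / 2"
      using min[OF X(1)] X(2) by (simp add: energy_def A_def q_def add_divide_distrib)
    also have "\<dots> = (A + e n / 2 * q) * e n" by (simp add: algebra_simps power2_eq_square)
    finally show ?thesis using e[of n] by simp
  qed
  have "(\<lambda>n. LINT x:\<Omega>|lborel. D n x) \<longlonglongrightarrow> (LINT x:\<Omega>|lborel. h (u x) * \<phi> x)"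
    unfolding set_lebesgue_integral_def
  proof (rule integral_dominated_convergence[where w = "\<lambda>x. K * \<bar>\<phi> x\<bar>"])
    show "integrable lborel (\<lambda>x. K * \<bar>\<phi> x\<bar>)" using X0_integrable[OF \<phi> \<Omega>] by simp
    show "AE x in lborel. (\<lambda>n. indicat_real \<Omega> x *\<^sub>R D n x)
        \<longlonglongrightarrow> indicat_real \<Omega> x *\<^sub>R (h (u x) * \<phi> x)"
    proof (intro AE_I2 tendsto_intros)
      fix x
      have "((\<lambda>t. G (u x + t * \<phi> x)) has_real_derivative h (u x) * \<phi> x) (at 0)"
        by (rule DERIV_chain2[where f = G]) (use G(1)[of "u x"] in \<open>auto intro!: derivative_eq_intros\<close>)
      then have *: "((\<lambda>t. (G (u x + t * \<phi> x) - G (u x)) / t) \<longlongrightarrow> h (u x) * \<phi> x) (at 0)"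
        by (simp add: DERIV_def)
      have "filterlim e (at 0) sequentially"
        using e e0 by (simp add: filterlim_at)
      from filterlim_compose[OF * this]
      show "(\<lambda>n. D n x) \<longlonglongrightarrow> h (u x) * \<phi> x" by (simp add: D_def)
    qed
    show "AE x in lborel. norm (indicat_real \<Omega> x *\<^sub>R D n x) \<le> K * \<bar>\<phi> x\<bar>" for n
    proof (intro AE_I2)
      fix x
      have "\<bar>D n x\<bar> \<le> K * \<bar>\<phi> x\<bar>"
        using lip[of "u x + e n * \<phi> x" "u x"] e[of n] by (simp add: D_def abs_mult field_simps)
      then show "norm (indicat_real \<Omega> x *\<^sub>R D n x) \<le> K * \<bar>\<phi> x\<bar>"
        by (auto simp: indicator_def)
    qed
    show "(\<lambda>x. indicat_real \<Omega> x *\<^sub>R D n x) \<in> borel_measurable lborel" for n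
      unfolding D_def by measurable
  qed measurable
  moreover have "(\<lambda>n. A + e n / 2 * q) \<longlonglongrightarrow> A + 0 / 2 * q"
    by (intro tendsto_intros e0) auto
  ultimately have "(LINT x:\<Omega>|lborel. h (u x) * \<phi> x) \<le> A + 0 / 2 * q"
    by (rule LIMSEQ_le) (use le in blast)
  then show ?thesis by (simp add: A_def)
qed

text \<open>The sign conditions on \<open>h\<close> make \<open>G\<close> nondecreasing below
  \<open>0\<close> and nonincreasing above \<open>b\<close>, so clamping shows that \<open>u\<close>
  minimizes over all of \<open>X0\<close>. The variational inequality for \<open>\<phi>\<close> and
  for \<open>- \<phi>\<close> then gives equality.\<close>

lemma minimizer_euler_lagrange:
  fixes u \<phi> :: "'n::finite rfun" and G h :: "real \<Rightarrow> real"
  assumes \<Omega>: "open \<Omega>" "bounded \<Omega>" and b: "0 \<le> b"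
    and G: "\<And>t. (G has_real_derivative h t) (at t)" "G 0 = 0"
    and h: "continuous_on UNIV h" "\<And>t. \<bar>h t\<bar> \<le> K"
      "\<And>t. t \<le> 0 \<Longrightarrow> 0 \<le> h t" "\<And>t. b \<le> t \<Longrightarrow> h t \<le> 0"
    and u: "u \<in> X0_between s \<Omega> b"
    and min: "\<And>v. v \<in> X0_between s \<Omega> b \<Longrightarrow> energy s \<Omega> G u \<le> energy s \<Omega> G v"
    and \<phi>: "\<phi> \<in> X0 s \<Omega>"
  shows "(\<integral>z. gag s u \<phi> z \<partial>lborel2) = (LINT x:\<Omega>|lborel. h (u x) * \<phi> x)"
proof (rule antisym)
  have Gc: "continuous_on UNIV G"
    using G(1) by (meson DERIV_isCont continuous_at_imp_continuous_on)
  have Gb: "\<bar>G t\<bar> \<le> K * \<bar>t\<bar>" for t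
    using lipschitz_of_bounded_derivative[OF G(1) h(2), of t 0] G(2) by simp
  have G0: "G t \<le> G 0" if "t \<le> 0" for t
    by (rule DERIV_nonneg_imp_nondecreasing[OF that]) (use G(1) h(3) in force)
  have G1: "G t \<le> G b" if "b \<le> t" for t
    by (rule DERIV_nonpos_imp_nonincreasing[OF that]) (use G(1) h(4) in force)
  have uX: "u \<in> X0 s \<Omega>" using u by (simp add: X0_between_def)
  have gmin: "energy s \<Omega> G u \<le> energy s \<Omega> G v" if "v \<in> X0 s \<Omega>" for v
    using energy_clamp_le[OF \<Omega> b Gc Gb G0 G1 that] min order_trans by blast
  note VI = minimizer_variational_inequality[OF \<Omega> G h(1,2) uX gmin]
  show "(LINT x:\<Omega>|lborel. h (u x) * \<phi> x) \<le> (\<integral>z. gag s u \<phi> z \<partial>lborel2)" by (rule VI[OF _ \<phi>])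
  have m: "(\<lambda>x. - \<phi> x) \<in> X0 s \<Omega>" using X0_linear(1)[OF X0_zero \<phi>, of "-1"] by simp
  have "gag s u (\<lambda>x. - \<phi> x) = (\<lambda>z. - gag s u \<phi> z)"
  proof -
    have "a * (- c - - d) / e = - (a * (c - d) / e)" for a c d e :: real
    proof -
      have "- c - - d = - (c - d)" by simp
      then show ?thesis by (simp only: mult_minus_right divide_minus_left)
    qed
    then show ?thesis unfolding gag_def split_def by (intro ext)
  qed
  then show "(\<integral>z. gag s u \<phi> z \<partial>lborel2) \<le> (LINT x:\<Omega>|lborel. h (u x) * \<phi> x)"
    using VI[OF _ m] by (simp add: set_lebesgue_integral_def)
qed

section \<open>Bump functions have finite Gagliardo energy\<close>

lemma ennreal_le_suminf:
  fixes f :: "nat \<Rightarrow> ennreal"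
  shows "f j \<le> (\<Sum>j. f j)"
  using sum_le_suminf[OF summableI, of "{j}" f] by simp

lemma nn_integral_lborel_shift:
  fixes f :: "'a::euclidean_space \<Rightarrow> ennreal"
  assumes [measurable]: "f \<in> borel_measurable borel"
  shows "(\<integral>\<^sup>+y. f (x - y) \<partial>lborel) = (\<integral>\<^sup>+y. f y \<partial>lborel)"
    and "(\<integral>\<^sup>+y. f (y - x) \<partial>lborel) = (\<integral>\<^sup>+y. f y \<partial>lborel)"
proof -
  show "(\<integral>\<^sup>+y. f (x - y) \<partial>lborel) = (\<integral>\<^sup>+y. f y \<partial>lborel)"
    by (subst (2) lborel_affine[of "-1" x]) (simp_all add: nn_integral_density nn_integral_distr)
  show "(\<integral>\<^sup>+y. f (y - x) \<partial>lborel) = (\<integral>\<^sup>+y. f y \<partial>lborel)"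
    by (subst (2) lborel_affine[of 1 "- x"]) (simp_all add: nn_integral_density nn_integral_distr)
qed

text \<open>Dyadic decomposition: on the shell \<open>2 powr -(j+1) < norm z \<le> 2 powr -j\<close> the integral is at
  most a multiple of \<open>2 powr (-j * (DIM('a) + 2 - \<beta>))\<close>, and symmetrically at infinity.\<close>

lemma nn_integral_truncated_kernel_finite:
  fixes \<beta> :: real
  assumes \<beta>: "real DIM('a::euclidean_space) < \<beta>" "\<beta> < real DIM('a) + 2"
  shows "(\<integral>\<^sup>+z. ennreal (min 1 ((norm (z::'a))\<^sup>2) / norm z powr \<beta>) \<partial>lborel) < \<infinity>"
proof -
  define N where "N = DIM('a)"
  define c where "c = unit_ball_vol (real N)"
  \<comment> \<open>\<open>A j\<close> and \<open>B j\<close> bound the integrand on a dyadic shell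
    inside and outside the unit ball: largest numerator over smallest denominator.
    \<open>RA j\<close> and \<open>RB j\<close> are the outer radii of the shells.\<close>
  define A where "A j = (2 powr - real j)\<^sup>2 / (2 powr - (real j + 1)) powr \<beta>" for j :: nat
  define B where "B j = 1 / (2 powr real j) powr \<beta>" for j :: nat
  define RA where "RA j = 2 powr - real j" for j :: nat
  define RB where "RB j = 2 powr (real j + 1)" for j :: nat
  have AB0: "0 \<le> A j" "0 \<le> B j" "0 \<le> RA j" "0 \<le> RB j" for j
    by (auto simp: A_def B_def RA_def RB_def)
  have c0: "0 \<le> c" by (simp add: c_def)
  \<comment> \<open>Each nonzero \<open>z\<close> lies in some shell; replacing shells by the balls
    that contain them keeps the bound and makes the volumes explicit.\<close>
  have pw: "ennreal (min 1 ((norm z)\<^sup>2) / norm z powr \<beta>)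
      \<le> (\<Sum>j. ennreal (A j) * indicator (cball 0 (RA j)) z)
        + (\<Sum>j. ennreal (B j) * indicator (cball 0 (RB j)) z)" (is "_ \<le> ?S + ?T") for z :: 'a
  proof (cases "z = 0")
    case False
    define n where "n = norm z"
    have n: "0 < n" using False by (simp add: n_def)
    have nl: "n = 2 powr log 2 n" using n by simp
    have b0: "0 \<le> \<beta>" using \<beta>(1) by (meson less_imp_le of_nat_0_le_iff order_trans)
    show ?thesis
    proof (cases "n < 1")
      case True
      define j where "j = nat \<lfloor>- log 2 n\<rfloor>"
      have "log 2 n < 0" using n True by simp
      then have "real j \<le> - log 2 n" "- log 2 n < real j + 1" unfolding j_def by linarith+
      then have j: "n \<le> 2 powr - real j" "2 powr - (real j + 1) \<le> n"
        by (subst nl, simp)+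
      have "min 1 (n\<^sup>2) / n powr \<beta> \<le> A j"
        unfolding A_def
      proof (rule frac_le)
        show "min 1 (n\<^sup>2) \<le> (2 powr - real j)\<^sup>2"
          using power_mono[OF j(1), of 2] n by (simp add: min.coboundedI2)
        show "(2 powr - (real j + 1)) powr \<beta> \<le> n powr \<beta>"
          using j b0 by (intro powr_mono2) auto
      qed auto
      then have "ennreal (min 1 (n\<^sup>2) / n powr \<beta>) \<le> ennreal (A j) * indicator (cball 0 (RA j)) z"
        using j(1) by (simp add: RA_def n_def ennreal_leI)
      also have "\<dots> \<le> ?S"
        by (rule ennreal_le_suminf)
      finally show ?thesis by (simp add: n_def add_increasing2)
    next
      case False
      define j where "j = nat \<lfloor>log 2 n\<rfloor>"
      have "log 2 n \<ge> 0" using n False by simp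
      then have "real j \<le> log 2 n" "log 2 n < real j + 1" unfolding j_def by linarith+
      then have j: "2 powr real j \<le> n" "n \<le> 2 powr (real j + 1)"
        by (subst nl, simp)+
      have "min 1 (n\<^sup>2) / n powr \<beta> \<le> B j"
        unfolding B_def
      proof (rule frac_le)
        show "(2 powr real j) powr \<beta> \<le> n powr \<beta>"
          using j b0 by (intro powr_mono2) auto
      qed auto
      then have "ennreal (min 1 (n\<^sup>2) / n powr \<beta>) \<le> ennreal (B j) * indicator (cball 0 (RB j)) z"
        using j(2) by (simp add: RB_def n_def ennreal_leI)
      also have "\<dots> \<le> ?T"
        by (rule ennreal_le_suminf)
      finally show ?thesis by (simp add: n_def add_increasing)
    qed
  qed simp
  have [measurable]: "cball (0::'a) r \<in> sets borel" for r by simp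
  have emb: "emeasure lborel (cball (0::'a) R) = ennreal (c * R ^ N)" if "0 \<le> R" for R
    using emeasure_cball[OF that, of "0::'a"] by (simp add: c_def N_def)
  \<comment> \<open>Both series are geometric: the ratio of the inner one is below \<open>1\<close>
    because \<open>\<beta> < N + 2\<close>, that of the outer one because
    \<open>N < \<beta>\<close>.\<close>
  have "A j * (c * RA j ^ N) = c * 2 powr \<beta> * (2 powr - (real N + 2 - \<beta>)) ^ j" for j
    by (simp add: A_def RA_def powr_powr powr_diff[symmetric] powr_add[symmetric]
        flip: powr_realpow) (simp add: algebra_simps powr_powr powr_diff powr_add powr_minus divide_simps)
  moreover have "2 powr - (real N + 2 - \<beta>) < 2 powr 0"
    using \<beta> by (subst powr_less_cancel_iff) (auto simp: N_def)
  ultimately have SA: "summable (\<lambda>j. A j * (c * RA j ^ N))"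
    by (simp only:) (intro summable_mult summable_geometric, simp)
  have "B j * (c * RB j ^ N) = c * 2 powr N * (2 powr - (\<beta> - real N)) ^ j" for j
    by (simp add: B_def RB_def powr_powr powr_diff[symmetric] powr_add[symmetric]
        flip: powr_realpow) (simp add: algebra_simps powr_powr powr_diff powr_add powr_minus divide_simps)
  moreover have "2 powr - (\<beta> - real N) < 2 powr 0"
    using \<beta> by (subst powr_less_cancel_iff) (auto simp: N_def)
  ultimately have SB: "summable (\<lambda>j. B j * (c * RB j ^ N))"
    by (simp only:) (intro summable_mult summable_geometric, simp)
  have int: "(\<integral>\<^sup>+z. (\<Sum>j. ennreal (X j) * indicator (cball (0::'a) (R j)) z) \<partial>lborel)
     = (\<Sum>j. ennreal (X j) * ennreal (c * R j ^ N))" if "\<And>j. 0 \<le> R j" for X R :: "nat \<Rightarrow> real"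
  proof (subst nn_integral_suminf)
    show "(\<Sum>j. \<integral>\<^sup>+z. ennreal (X j) * indicator (cball (0::'a) (R j)) z \<partial>lborel)
       = (\<Sum>j. ennreal (X j) * ennreal (c * R j ^ N))"
      by (subst nn_integral_cmult_indicator) (simp_all only: emb[OF that] sets_lborel borel_closed closed_cball)
  qed measurable
  have "(\<integral>\<^sup>+z. ennreal (min 1 ((norm (z::'a))\<^sup>2) / norm z powr \<beta>) \<partial>lborel)
     \<le> (\<integral>\<^sup>+z. (\<Sum>j. ennreal (A j) * indicator (cball (0::'a) (RA j)) z)
        + (\<Sum>j. ennreal (B j) * indicator (cball 0 (RB j)) z) \<partial>lborel)"
    by (intro nn_integral_mono pw)
  also have "\<dots> = (\<integral>\<^sup>+z. (\<Sum>j. ennreal (A j) * indicator (cball (0::'a) (RA j)) z) \<partial>lborel)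
        + (\<integral>\<^sup>+z. (\<Sum>j. ennreal (B j) * indicator (cball (0::'a) (RB j)) z) \<partial>lborel)"
    by (intro nn_integral_add) measurable
  also have "\<dots> = (\<Sum>j. ennreal (A j) * ennreal (c * RA j ^ N)) + (\<Sum>j. ennreal (B j) * ennreal (c * RB j ^ N))"
    by (simp only: int AB0)
  also have "\<dots> = (\<Sum>j. ennreal (A j * (c * RA j ^ N))) + (\<Sum>j. ennreal (B j * (c * RB j ^ N)))"
    by (subst (1 2) ennreal_mult) (simp_all only: AB0 c0 zero_le_power mult_nonneg_nonneg)
  also have "\<dots> < \<infinity>"
  proof -
    have "(\<Sum>j. ennreal (A j * (c * RA j ^ N))) \<noteq> top" "(\<Sum>j. ennreal (B j * (c * RB j ^ N))) \<noteq> top"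
      by (rule ennreal_suminf_neq_top[OF SA] ennreal_suminf_neq_top[OF SB],
          intro mult_nonneg_nonneg zero_le_power AB0 c0)+
    then show ?thesis unfolding infinity_ennreal_def less_top[symmetric] ennreal_add_eq_top by blast
  qed
  finally show ?thesis .
qed

text \<open>The squared difference is at most \<open>M * min 1 (norm (x - y))^2\<close> and vanishes
  unless \<open>x\<close> or \<open>y\<close> lies in the ball. The double integral is thus
  controlled by the measure of the ball times the kernel integral, finite because
  \<open>0 < s < 1\<close>.\<close>

lemma gag_integrable_lipschitz:
  fixes w :: "'n::finite rfun"
  assumes s: "0 < s" "s < 1" and [measurable]: "w \<in> borel_measurable lborel"
    and lip: "\<And>x y. \<bar>w x - w y\<bar> \<le> L * norm (x - y)" "\<And>x y. \<bar>w x - w y\<bar> \<le> 1"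
    and zero: "\<And>x. x \<notin> ball x0 R \<Longrightarrow> w x = 0"
  shows "integrable lborel2 (gag s w w)"
proof -
  define \<beta> where "\<beta> = real CARD('n) + 2 * s"
  define k where "k z = min 1 ((norm z)\<^sup>2) / norm z powr \<beta>" for z :: "real^'n"
  define M where "M = max 1 (L\<^sup>2)"
  have [measurable]: "k \<in> borel_measurable borel" "ball x0 R \<in> sets borel"
    unfolding k_def by measurable
  have kfin: "(\<integral>\<^sup>+z. ennreal (k z) \<partial>lborel) < \<infinity>"
    unfolding k_def by (rule nn_integral_truncated_kernel_finite) (use s in \<open>auto simp: \<beta>_def\<close>)
  have bfin: "emeasure lborel (ball x0 R) < \<infinity>" using emeasure_bounded_finite[OF bounded_ball] .
  have sq: "(w x - w y) * (w x - w y) \<le> M * min 1 ((norm (x - y))\<^sup>2)" for x y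
  proof -
    have "(w x - w y)\<^sup>2 \<le> 1" using lip(2)[of x y] by (simp add: abs_square_le_1)
    moreover have "(w x - w y)\<^sup>2 \<le> L\<^sup>2 * (norm (x - y))\<^sup>2"
      using power_mono[OF lip(1)[of x y], of 2] by (simp add: power_mult_distrib)
    moreover have "L\<^sup>2 * (norm (x - y))\<^sup>2 \<le> M * (norm (x - y))\<^sup>2"
      by (intro mult_right_mono) (auto simp: M_def)
    moreover have "1 \<le> M" by (simp add: M_def)
    ultimately show ?thesis by (simp add: power2_eq_square min_def)
  qed
  \<comment> \<open>\<open>P\<close> covers the pairs with first point in the ball, \<open>Q\<close>
    those with second point in it; each is integrated along the other variable first.\<close>
  define P where "P z = indicator (ball x0 R) (fst z) * ennreal (k (fst z - snd z))" for z
  define Q where "Q z = indicator (ball x0 R) (snd z) * ennreal (k (fst z - snd z))" for z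
  have [measurable]: "P \<in> borel_measurable lborel2" "Q \<in> borel_measurable lborel2"
    unfolding P_def Q_def by measurable
  have le: "ennreal (norm (gag s w w z)) \<le> ennreal M * (P z + Q z)" for z
  proof -
    obtain x y where z: "z = (x, y)" by (cases z)
    show ?thesis
    proof (cases "x \<in> ball x0 R \<or> y \<in> ball x0 R")
      case True
      have "norm (gag s w w z) \<le> M * k (x - y)"
        unfolding z k_def gag_def \<beta>_def using divide_right_mono[OF sq] by simp
      then have "ennreal (norm (gag s w w z)) \<le> ennreal M * ennreal (k (x - y))"
        by (subst ennreal_mult[symmetric]) (auto simp: M_def k_def intro!: ennreal_leI)
      also have "\<dots> \<le> ennreal M * (P z + Q z)"
        using True by (intro mult_left_mono) (auto simp: indicator_def z P_def Q_def)
      finally show ?thesis .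
    qed (simp add: gag_def z zero)
  qed
  define I where "I = (\<integral>\<^sup>+z. ennreal (k z) \<partial>lborel)"
  note shift = nn_integral_lborel_shift[where f = "\<lambda>z. ennreal (k z)", simplified, folded I_def]
  have "(\<integral>\<^sup>+z. P z \<partial>lborel2) = (\<integral>\<^sup>+x. indicator (ball x0 R) x * I \<partial>lborel)"
    by (subst lborel.nn_integral_fst[symmetric]) (simp_all add: P_def nn_integral_cmult shift)
  then have P: "(\<integral>\<^sup>+z. P z \<partial>lborel2) = emeasure lborel (ball x0 R) * I"
    by (simp add: nn_integral_multc)
  have "(\<integral>\<^sup>+z. Q z \<partial>lborel2) = (\<integral>\<^sup>+y. indicator (ball x0 R) y * I \<partial>lborel)"
    by (subst lborel_pair.nn_integral_snd[symmetric]) (simp_all add: Q_def nn_integral_cmult shift)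
  then have Q: "(\<integral>\<^sup>+z. Q z \<partial>lborel2) = emeasure lborel (ball x0 R) * I"
    by (simp add: nn_integral_multc)
  have "(\<integral>\<^sup>+z. ennreal (norm (gag s w w z)) \<partial>lborel2) \<le> (\<integral>\<^sup>+z. ennreal M * (P z + Q z) \<partial>lborel2)"
    by (intro nn_integral_mono le)
  also have "\<dots> = ennreal M * (emeasure lborel (ball x0 R) * I + emeasure lborel (ball x0 R) * I)"
    by (simp add: nn_integral_cmult nn_integral_add P Q)
  also have "\<dots> < \<infinity>"
    using kfin bfin by (simp add: ennreal_mult_less_top I_def)
  finally show ?thesis
    by (intro integrableI_bounded gag_measurable) auto
qed

lemma X0_bump_exists:
  fixes \<Omega> :: "(real^'n::finite) set"
  assumes s: "0 < s" "s < 1" and \<Omega>: "open \<Omega>" "bounded \<Omega>" "\<Omega> \<noteq> {}"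
  obtains w x0 r where "w \<in> X0_between s \<Omega> 1" "0 < r" "ball x0 r \<subseteq> \<Omega>" "\<And>x. x \<in> ball x0 r \<Longrightarrow> w x = 1"
proof -
  obtain x0 R where R: "0 < R" "ball x0 R \<subseteq> \<Omega>"
    using \<Omega> by (meson ex_in_conv openE)
  define r where "r = R / 2"
  have r: "0 < r" "R = 2 * r" using R by (auto simp: r_def)
  \<comment> \<open>A radial cutoff: \<open>1\<close> up to radius \<open>r\<close>, then linear
    with slope \<open>- 1 / r\<close>, and \<open>0\<close> from radius \<open>2 * r\<close>
    on.\<close>
  define w where "w x = max 0 (min 1 (2 - dist x0 x / r))" for x
  have wm: "w \<in> borel_measurable lborel" unfolding w_def by measurable
  have z: "w x = 0" if "x \<notin> ball x0 R" for x
    using that r by (simp add: w_def field_simps)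
  have "integrable lborel2 (gag s w w)"
  proof (rule gag_integrable_lipschitz[OF s wm _ _ z])
    fix x y
    have "\<bar>w x - w y\<bar> \<le> \<bar>dist x0 x / r - dist x0 y / r\<bar>" by (simp add: w_def)
    also have "\<dots> = \<bar>dist x0 x - dist x0 y\<bar> / r" using r by (simp flip: diff_divide_distrib)
    also have "\<dots> \<le> dist x y / r" using r
      by (intro divide_right_mono) (metis abs_dist_diff_le dist_commute less_imp_le)+
    finally show "\<bar>w x - w y\<bar> \<le> (1 / r) * norm (x - y)" by (simp add: dist_norm)
    show "\<bar>w x - w y\<bar> \<le> 1" by (simp add: w_def)
  qed
  then have "w \<in> X0_between s \<Omega> 1"
    using z R by (intro X0_between_intro \<Omega>(1,2) wm AE_I2 impI z) (auto simp: w_def[abs_def])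
  moreover have "ball x0 r \<subseteq> \<Omega>" using R r by (intro order_trans[OF subset_ball R(2)]) simp
  moreover have "w x = 1" if "x \<in> ball x0 r" for x
    using that r by (simp add: w_def field_simps)
  ultimately show thesis using that r by blast
qed

section \<open>Truncated nonlinearities\<close>

text \<open>Since \<open>g\<close> vanishes on the left, \<open>primF g\<close> agrees near
  \<open>t\<close> with the integral from a fixed point \<open>- A\<close>. This covers
  \<open>t <= 0\<close>, where the interval \<open>{0..t}\<close> degenerates.\<close>

lemma primF_has_derivative:
  fixes g :: "real \<Rightarrow> real"
  assumes g: "continuous_on UNIV g" and z: "\<And>t. t \<le> 0 \<Longrightarrow> g t = 0"
  shows "(primF g has_real_derivative g t) (at t)"
proof -
  define A where "A = \<bar>t\<bar> + 1"
  have A: "0 < A" "- A < t" "t < A" by (auto simp: A_def)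
  have gi: "continuous_on {a..b} g" for a b using g continuous_on_subset by blast
  have eq: "integral {-A..x} g = primF g x" if "x \<in> {-A<..<A}" for x
  proof (cases "x \<le> 0")
    case True
    have "integral {-A..x} g = integral {-A..x} (\<lambda>_. 0)"
      using True z by (intro integral_cong) auto
    moreover have "primF g x = 0" using True by (cases "x = 0") (auto simp: primF_def)
    ultimately show ?thesis by simp
  next
    case False
    have "integral {-A..0} g + integral {0..x} g = integral {-A..x} g"
      using False A by (intro Henstock_Kurzweil_Integration.integral_combine integrable_continuous_real gi) auto
    moreover have "integral {-A..0} g = integral {-A..0} (\<lambda>_. 0)"
      using z by (intro integral_cong) auto
    ultimately show ?thesis by (simp add: primF_def)
  qed
  have "((\<lambda>x. integral {-A..x} g) has_real_derivative g t) (at t within {-A..A})"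
    using A by (intro integral_has_real_derivative gi) auto
  then have "((\<lambda>x. integral {-A..x} g) has_real_derivative g t) (at t)"
    using A by (simp add: at_within_Icc_at)
  then show ?thesis
    by (rule has_field_derivative_transform_within_open[where S = "{-A<..<A}"]) (use A eq in auto)
qed

lemma primF_zero: "primF g 0 = 0"
  by (simp add: primF_def)

text \<open>Freezing the argument outside \<open>{0..b}\<close> yields a bounded continuous
  nonlinearity whose sign beyond \<open>b\<close> is decided by its value at
  \<open>b\<close>.\<close>

definition trunc_rhs :: "real \<Rightarrow> real \<Rightarrow> (real \<Rightarrow> real) \<Rightarrow> real \<Rightarrow> real \<Rightarrow> real" where
  "trunc_rhs lam p f b t = lam * (max 0 (min b t)) powr p + f (max 0 (min b t))"

context
  fixes f :: "real \<Rightarrow> real" and p b :: real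
  assumes f: "continuous_on {0..} f" "f 0 = 0" and p: "0 < p" and b: "0 \<le> b"
begin

lemma trunc_rhs_continuous: "continuous_on UNIV (trunc_rhs lam p f b)"
proof -
  have "continuous_on UNIV (\<lambda>t. f (max 0 (min b t)))"
    by (rule continuous_on_compose2[OF f(1)]) (auto intro!: continuous_intros)
  moreover have "continuous_on UNIV (\<lambda>t. (max 0 (min b t)) powr p)"
    using p by (intro continuous_on_powr' continuous_intros) auto
  ultimately show ?thesis
    unfolding trunc_rhs_def by (intro continuous_on_add continuous_on_mult continuous_on_const)
qed

lemma trunc_rhs_nonpos: "t \<le> 0 \<Longrightarrow> trunc_rhs lam p f b t = 0"
proof -
  assume "t \<le> 0"
  then have "max 0 (min b t) = 0" by linarith
  then show ?thesis using f(2) p by (simp add: trunc_rhs_def)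
qed

lemma trunc_rhs_ge: "b \<le> t \<Longrightarrow> trunc_rhs lam p f b t = lam * b powr p + f b"
  using b by (simp add: trunc_rhs_def)

lemma trunc_rhs_between: "0 \<le> t \<Longrightarrow> t \<le> b \<Longrightarrow> trunc_rhs lam p f b t = lam * t powr p + f t"
  by (simp add: trunc_rhs_def)

lemma powr_clamp_le: "b \<le> 1 \<Longrightarrow> (max 0 (min b t)) powr p \<le> 1"
  using p b by (intro powr_le1) auto

lemma primF_trunc_rhs_has_derivative:
  "(primF (trunc_rhs lam p f b) has_real_derivative trunc_rhs lam p f b t) (at t)"
  by (intro primF_has_derivative trunc_rhs_continuous trunc_rhs_nonpos)

lemma primF_trunc_rhs_continuous: "continuous_on UNIV (primF (trunc_rhs lam p f b))"
  using primF_trunc_rhs_has_derivative by (meson DERIV_isCont continuous_at_imp_continuous_on)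

lemma primF_trunc_rhs_zero: "t \<le> b \<Longrightarrow> primF (trunc_rhs 0 p f b) t = primF f t"
  unfolding primF_def by (intro integral_cong) (auto simp: trunc_rhs_def)

lemma trunc_rhs_bound:
  assumes "\<And>t. 0 \<le> t \<Longrightarrow> t \<le> 1 \<Longrightarrow> \<bar>f t\<bar> \<le> K" "\<bar>lam\<bar> \<le> 1" "b \<le> 1"
  shows "\<bar>trunc_rhs lam p f b t\<bar> \<le> 1 + K"
proof -
  have "\<bar>lam * (max 0 (min b t)) powr p\<bar> \<le> 1 * 1"
    unfolding abs_mult using assms powr_clamp_le by (intro mult_mono) auto
  moreover have "\<bar>f (max 0 (min b t))\<bar> \<le> K" using assms(3) b by (intro assms(1)) auto
  ultimately show ?thesis unfolding trunc_rhs_def by linarith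
qed

lemma primF_trunc_rhs_bound:
  assumes "\<And>t. 0 \<le> t \<Longrightarrow> t \<le> 1 \<Longrightarrow> \<bar>f t\<bar> \<le> K" "\<bar>lam\<bar> \<le> 1" "b \<le> 1"
  shows "\<bar>primF (trunc_rhs lam p f b) t\<bar> \<le> (1 + K) * \<bar>t\<bar>"
  using lipschitz_of_bounded_derivative[OF primF_trunc_rhs_has_derivative trunc_rhs_bound[OF assms], of t 0]
  by (simp add: primF_zero)

text \<open>The derivative of the difference is \<open>lam\<close> times a power of a number in
  \<open>{0..1}\<close>. Energy levels therefore move at most linearly in
  \<open>lam\<close>.\<close>

lemma primF_trunc_rhs_diff:
  assumes "b \<le> 1"
  shows "\<bar>primF (trunc_rhs lam p f b) t - primF (trunc_rhs 0 p f b) t\<bar> \<le> \<bar>lam\<bar> * \<bar>t\<bar>"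
proof -
  define D where "D t = primF (trunc_rhs lam p f b) t - primF (trunc_rhs 0 p f b) t" for t
  have "(D has_real_derivative (trunc_rhs lam p f b t - trunc_rhs 0 p f b t)) (at t)" for t
    unfolding D_def by (intro DERIV_diff primF_trunc_rhs_has_derivative)
  moreover have "\<bar>trunc_rhs lam p f b t - trunc_rhs 0 p f b t\<bar> \<le> \<bar>lam\<bar>" for t
    using mult_left_mono[OF powr_clamp_le[OF assms, of t], of "\<bar>lam\<bar>"]
    by (simp add: trunc_rhs_def abs_mult)
  ultimately have "\<bar>D t - D 0\<bar> \<le> \<bar>lam\<bar> * \<bar>t - 0\<bar>" by (rule lipschitz_of_bounded_derivative)
  then show ?thesis by (simp add: D_def primF_zero)
qed

text \<open>The condition \<open>neg\<close> is the sign at \<open>b\<close> that the Euler-Lagrange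
  lemma asks for, and the truncation is invisible to a function with values in
  \<open>{0..b}\<close>.\<close>

lemma truncated_minimizer_weak_solution:
  fixes u :: "'n::finite rfun"
  assumes \<Omega>: "open \<Omega>" "bounded \<Omega>" and neg: "lam * b powr p + f b \<le> 0"
    and K: "\<And>t. 0 \<le> t \<Longrightarrow> t \<le> 1 \<Longrightarrow> \<bar>f t\<bar> \<le> K" "\<bar>lam\<bar> \<le> 1" "b \<le> 1"
    and u: "u \<in> X0_between s \<Omega> b"
    and min: "\<And>v. v \<in> X0_between s \<Omega> b \<Longrightarrow>
      energy s \<Omega> (primF (trunc_rhs lam p f b)) u \<le> energy s \<Omega> (primF (trunc_rhs lam p f b)) v"
  shows "weak_solution s \<Omega> lam p f u"
  unfolding weak_solution_def
proof (intro conjI ballI)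
  show uX: "u \<in> X0 s \<Omega>" using u by (simp add: X0_between_def)
  fix \<phi> assume \<phi>: "\<phi> \<in> X0 s \<Omega>"
  have ub: "0 \<le> u x \<and> u x \<le> b" for x using u by (auto simp: X0_between_def)
  have [measurable]: "trunc_rhs 0 p f b \<in> borel_measurable borel" "\<Omega> \<in> sets borel"
      "u \<in> borel_measurable lborel" "\<phi> \<in> borel_measurable lborel"
    using trunc_rhs_continuous \<Omega> uX \<phi> by (simp_all add: borel_measurable_continuous_onI X0_def)
  have mult_int: "set_integrable lborel \<Omega> (\<lambda>x. g x * \<phi> x)"
    if [measurable]: "g \<in> borel_measurable lborel" and "\<And>x. \<bar>g x\<bar> \<le> C" for g C
    unfolding set_integrable_def
  proof (rule Bochner_Integration.integrable_bound)
    show "integrable lborel (\<lambda>x. C * \<phi> x)" using X0_integrable[OF \<phi> \<Omega>] by simp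
    show "AE x in lborel. norm (indicat_real \<Omega> x *\<^sub>R (g x * \<phi> x)) \<le> norm (C * \<phi> x)"
    proof (intro AE_I2)
      fix x
      have "\<bar>g x\<bar> * \<bar>\<phi> x\<bar> \<le> \<bar>C\<bar> * \<bar>\<phi> x\<bar>"
        using that(2)[of x] by (intro mult_right_mono) auto
      then show "norm (indicat_real \<Omega> x *\<^sub>R (g x * \<phi> x)) \<le> norm (C * \<phi> x)"
        by (auto simp: indicator_def abs_mult)
    qed
  qed measurable
  have "(\<integral>z. gag s u \<phi> z \<partial>lborel2) = (LINT x:\<Omega>|lborel. trunc_rhs lam p f b (u x) * \<phi> x)"
    by (rule minimizer_euler_lagrange[OF \<Omega> b primF_trunc_rhs_has_derivative primF_zero
          trunc_rhs_continuous trunc_rhs_bound[OF K] _ _ u min \<phi>])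
      (simp_all add: trunc_rhs_nonpos trunc_rhs_ge neg)
  \<comment> \<open>\<open>trunc_rhs 0 p f b\<close> is the \<open>f\<close> part alone; it stays
    truncated until the integral is split, because its boundedness gives integrability.\<close>
  also have "(\<lambda>x. trunc_rhs lam p f b (u x) * \<phi> x)
      = (\<lambda>x. lam * ((max (u x) 0) powr p * \<phi> x) + trunc_rhs 0 p f b (u x) * \<phi> x)"
    using ub by (intro ext) (simp add: trunc_rhs_between algebra_simps max_absorb1)
  also have "(LINT x:\<Omega>|lborel. lam * ((max (u x) 0) powr p * \<phi> x) + trunc_rhs 0 p f b (u x) * \<phi> x)
      = lam * (LINT x:\<Omega>|lborel. (max (u x) 0) powr p * \<phi> x)
        + (LINT x:\<Omega>|lborel. trunc_rhs 0 p f b (u x) * \<phi> x)"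
  proof -
    have "set_integrable lborel \<Omega> (\<lambda>x. (max (u x) 0) powr p * \<phi> x)"
    proof (rule mult_int[of _ 1])
      show "\<bar>(max (u x) 0) powr p\<bar> \<le> 1" for x
        using ub[of x] K(3) p by (simp add: powr_le1)
    qed measurable
    moreover have "set_integrable lborel \<Omega> (\<lambda>x. trunc_rhs 0 p f b (u x) * \<phi> x)"
      by (rule mult_int, measurable) (rule trunc_rhs_bound[OF K(1) _ K(3)], simp_all)
    ultimately show ?thesis by simp
  qed
  \<comment> \<open>As \<open>u\<close> is nonnegative, the extension by \<open>0\<close> only
    concerns points with \<open>u x = 0\<close>, where \<open>f 0 = 0\<close> gives the same
    value.\<close>
  also have "(\<lambda>x. trunc_rhs 0 p f b (u x) * \<phi> x) = (\<lambda>x. (if u x \<le> 0 then 0 else f (u x)) * \<phi> x)"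
  proof
    fix x
    have "u x = 0" if "u x \<le> 0" using ub[of x] that by simp
    then show "trunc_rhs 0 p f b (u x) * \<phi> x = (if u x \<le> 0 then 0 else f (u x)) * \<phi> x"
      using ub[of x] f(2) by (auto simp: trunc_rhs_between)
  qed
  finally show "(\<integral>z. gag s u \<phi> z \<partial>lborel2) =
      lam * (LINT x:\<Omega>|lborel. (max (u x) 0) powr p * \<phi> x)
      + (LINT x:\<Omega>|lborel. (if u x \<le> 0 then 0 else f (u x)) * \<phi> x)" .
qed

end

section \<open>Size and perturbation of the potential energy\<close>

lemma potential_bound:
  fixes u :: "'n::finite rfun" and G :: "real \<Rightarrow> real"
  assumes \<Omega>: "open \<Omega>" "bounded \<Omega>" and G: "continuous_on UNIV G"
    and u: "u \<in> X0_between s \<Omega> b" and B: "\<And>t. 0 \<le> t \<Longrightarrow> t \<le> b \<Longrightarrow> \<bar>G t\<bar> \<le> B"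
  shows "\<bar>LINT x:\<Omega>|lborel. G (u x)\<bar> \<le> B * measure lborel \<Omega>"
proof -
  have i: "set_integrable lborel \<Omega> (\<lambda>x. G (u x))"
    by (rule set_integrable_comp_between[OF \<Omega> G u])
  have iB: "set_integrable lborel \<Omega> (\<lambda>x. C)" for C :: real
    by (rule set_integrable_bounded[OF \<Omega>, of _ "\<bar>C\<bar>"]) auto
  have c: "(LINT x:\<Omega>|lborel. C) = C * measure lborel \<Omega>" for C :: real
    by (simp add: set_lebesgue_integral_def)
  have bd: "- B \<le> G (u x)" "G (u x) \<le> B" for x
  proof -
    have "0 \<le> u x" "u x \<le> b" using u by (auto simp: X0_between_def)
    from B[OF this] show "- B \<le> G (u x)" "G (u x) \<le> B" by linarith+
  qed
  have "(LINT x:\<Omega>|lborel. G (u x)) \<le> (LINT x:\<Omega>|lborel. B)"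
    by (intro set_integral_mono i iB bd)
  moreover have "(LINT x:\<Omega>|lborel. - B) \<le> (LINT x:\<Omega>|lborel. G (u x))"
    by (intro set_integral_mono i iB bd)
  ultimately show ?thesis by (simp only: c)
qed

lemma energy_perturbation:
  fixes u :: "'n::finite rfun" and G G' :: "real \<Rightarrow> real"
  assumes \<Omega>: "open \<Omega>" "bounded \<Omega>" and G: "continuous_on UNIV G" "continuous_on UNIV G'"
    and u: "u \<in> X0_between s \<Omega> b" and B: "\<And>t. 0 \<le> t \<Longrightarrow> t \<le> b \<Longrightarrow> \<bar>G t - G' t\<bar> \<le> B"
  shows "energy s \<Omega> G u \<le> energy s \<Omega> G' u + B * measure lborel \<Omega>"
proof -
  have "\<bar>LINT x:\<Omega>|lborel. G (u x) - G' (u x)\<bar> \<le> B * measure lborel \<Omega>"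
    by (rule potential_bound[OF \<Omega> _ u B]) (intro continuous_intros G)
  moreover have "(LINT x:\<Omega>|lborel. G (u x) - G' (u x)) = (LINT x:\<Omega>|lborel. G (u x)) - (LINT x:\<Omega>|lborel. G' (u x))"
    using set_integrable_comp_between[OF \<Omega> G(1) u] set_integrable_comp_between[OF \<Omega> G(2) u] by simp
  ultimately show ?thesis unfolding energy_def by linarith
qed

section \<open>Separated negative energy levels\<close>

text \<open>Test with \<open>t * w\<close> for a bump \<open>w\<close>: every term scales like
  \<open>t^2\<close>, and for a suitable small \<open>t\<close> the gain on the plateau of
  \<open>w\<close> has as large a factor \<open>K\<close> as desired, beating the Gagliardo part and
  the loss elsewhere.\<close>

lemma exists_negative_energy:
  fixes \<Omega> :: "(real^'n::finite) set" and G :: "real \<Rightarrow> real"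
  assumes s: "0 < s" "s < 1" and \<Omega>: "open \<Omega>" "bounded \<Omega>" "\<Omega> \<noteq> {}"
    and G: "continuous_on UNIV G" "G 0 = 0"
    and lower: "\<forall>\<^sub>F t in at_right 0. - C * t\<^sup>2 \<le> G t"
    and upper: "\<And>K. \<exists>\<^sub>F t in at_right 0. K * t\<^sup>2 < G t"
    and b: "0 < b"
  obtains v where "v \<in> X0_between s \<Omega> b" "energy s \<Omega> G v < 0"
proof -
  obtain w x0 r where w: "w \<in> X0_between s \<Omega> 1" and r: "0 < r" "ball x0 r \<subseteq> \<Omega>"
    and w1: "\<And>x. x \<in> ball x0 r \<Longrightarrow> w x = 1"
    by (rule X0_bump_exists[OF s \<Omega>]) blast
  have wX: "w \<in> X0 s \<Omega>" and wb: "0 \<le> w x \<and> w x \<le> 1" for x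
    using w by (auto simp: X0_between_def)
  define \<mu> where "\<mu> = measure lborel (ball x0 r)"
  have \<mu>: "0 < \<mu>" unfolding \<mu>_def using r by (simp add: content_ball_pos)
  define V where "V = measure lborel \<Omega>"
  define q where "q = (\<integral>z. gag s w w z \<partial>lborel2)"
  have q0: "0 \<le> q" by (simp add: q_def gag_self_nonneg)
  \<comment> \<open>\<open>C\<close> may be negative; with its absolute value the lower bound at
    \<open>v x\<close> is at least the one at the larger argument \<open>t\<close>.\<close>
  define D where "D = \<bar>C\<bar>"
  \<comment> \<open>Chosen so that the total energy is at most
    \<open>- t^2 * (q / 2 + 1)\<close>.\<close>
  define K where "K = (q + D * V + 1) / \<mu>"
  have K0: "0 \<le> K" using q0 \<mu> by (simp add: K_def D_def V_def)
  obtain \<delta> where \<delta>: "0 < \<delta>" "\<And>t. 0 < t \<Longrightarrow> t < \<delta> \<Longrightarrow> - C * t\<^sup>2 \<le> G t"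
    using lower unfolding eventually_at_right_field by auto
  have "\<forall>\<^sub>F t in at_right 0. 0 < t \<and> t < min \<delta> b"
    using \<delta>(1) b by (auto simp: eventually_at_right_field intro!: exI[of _ "min \<delta> b"])
  from frequently_eventually_conj[OF upper[of K] this]
  obtain t where t: "K * t\<^sup>2 < G t" "0 < t" "t < \<delta>" "t < b"
    by (auto dest!: frequently_ex)
  define v where "v x = t * w x" for x
  have "(\<lambda>x. 0 + t * w x) \<in> X0 s \<Omega>" by (rule X0_linear(1)[OF X0_zero wX])
  then have vX: "v \<in> X0 s \<Omega>" by (simp add: v_def[abs_def])
  have vt: "0 \<le> v x \<and> v x \<le> t" for x
    using wb[of x] t(2) by (simp add: v_def mult_left_le)
  have vW: "v \<in> X0_between s \<Omega> b" using vX vt t by (auto simp: X0_between_def intro: order_trans less_imp_le)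
  have qv: "(\<integral>z. gag s v v z \<partial>lborel2) = t\<^sup>2 * q"
  proof -
    have "gag s v v = (\<lambda>z. t\<^sup>2 * gag s w w z)"
      by (auto simp: gag_def v_def fun_eq_iff power2_eq_square right_diff_distrib[symmetric])
    then show ?thesis by (simp add: q_def)
  qed
  have pw: "(K * t\<^sup>2) * indicator (ball x0 r) x - D * t\<^sup>2 \<le> G (v x)" for x
  proof (cases "x \<in> ball x0 r")
    case True
    then have "G (v x) = G t" by (simp add: v_def w1)
    moreover have "0 \<le> D * t\<^sup>2" by (simp add: D_def)
    ultimately show ?thesis using True t(1) by simp
  next
    case False
    have "- D * t\<^sup>2 \<le> G (v x)"
    proof (cases "v x = 0")
      case True
      then show ?thesis using G(2) by (simp add: D_def)
    next
      case nz: False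
      have "\<bar>C * (v x)\<^sup>2\<bar> \<le> D * t\<^sup>2"
        unfolding abs_mult D_def using vt[of x] by (intro mult_left_mono) (auto intro: power_mono)
      moreover have "- C * (v x)\<^sup>2 \<le> G (v x)"
        using vt[of x] nz t by (intro \<delta>(2)) auto
      ultimately show ?thesis by simp
    qed
    then show ?thesis using False by simp
  qed
  have [measurable]: "ball x0 r \<in> sets borel" by simp
  have ind: "set_integrable lborel \<Omega> (\<lambda>x. (K * t\<^sup>2) * indicator (ball x0 r) x)"
    by (rule set_integrable_bounded[OF \<Omega>(1,2), of _ "\<bar>K * t\<^sup>2\<bar>"]) (auto simp: indicator_def)
  have cst: "set_integrable lborel \<Omega> (\<lambda>x. D * t\<^sup>2)"
    by (rule set_integrable_bounded[OF \<Omega>(1,2), of _ "\<bar>D * t\<^sup>2\<bar>"]) auto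
  have "K * t\<^sup>2 * \<mu> - D * t\<^sup>2 * V
     = (LINT x:\<Omega>|lborel. (K * t\<^sup>2) * indicator (ball x0 r) x) - (LINT x:\<Omega>|lborel. D * t\<^sup>2)"
  proof -
    have "(\<lambda>x. indicat_real \<Omega> x * indicator (ball x0 r) x) = indicator (ball x0 r)"
      using r(2) by (auto simp: fun_eq_iff indicator_def)
    then have "(LINT x|lborel. indicat_real \<Omega> x * indicator (ball x0 r) x) = \<mu>"
      by (simp add: \<mu>_def)
    then show ?thesis by (simp add: set_lebesgue_integral_def V_def mult.left_commute)
  qed
  also have "\<dots> = (LINT x:\<Omega>|lborel. (K * t\<^sup>2) * indicator (ball x0 r) x - D * t\<^sup>2)"
    using ind cst by (simp add: set_integral_diff(2))
  also have "\<dots> \<le> (LINT x:\<Omega>|lborel. G (v x))"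
    using set_integrable_comp_between[OF \<Omega>(1,2) G(1) vW] pw ind cst
    by (intro set_integral_mono) (auto simp: set_integral_diff(1))
  finally have "energy s \<Omega> G v \<le> t\<^sup>2 * q / 2 - (K * t\<^sup>2 * \<mu> - D * t\<^sup>2 * V)"
    by (simp add: energy_def qv)
  also have "K * t\<^sup>2 * \<mu> = t\<^sup>2 * (q + D * V + 1)" using \<mu> by (simp add: K_def)
  also have "t\<^sup>2 * q / 2 - (t\<^sup>2 * (q + D * V + 1) - D * t\<^sup>2 * V) = - (t\<^sup>2 * (q / 2 + 1))"
    by (simp add: algebra_simps)
  also have "\<dots> < 0" using t(2) q0 by simp
  finally show thesis using that vW by blast
qed

text \<open>A lower bound on a Liminf holds eventually, whereas an infinite Limsup and a negative
  Liminf only give points arbitrarily close to \<open>0\<close>; hence the different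
  quantifiers.\<close>

lemma cond_f0_dest:
  assumes "cond_f0 f"
  shows "\<exists>C. \<forall>\<^sub>F t in at_right 0. - C * t\<^sup>2 \<le> primF f t"
    and "\<exists>\<^sub>F t in at_right 0. K * t\<^sup>2 < primF f t"
    and "\<exists>\<^sub>F t in at_right 0. f t < 0"
proof -
  have pos: "\<forall>\<^sub>F t::real in at_right 0. 0 < t" by (rule eventually_at_right_less)
  obtain r :: real where "ereal r < Liminf (at_right 0) (\<lambda>t. ereal (primF f t / t\<^sup>2))"
    using assms ereal_dense2 unfolding cond_f0_def by blast
  from less_LiminfD[OF this] have "\<forall>\<^sub>F t in at_right 0. r < primF f t / t\<^sup>2" by simp
  with pos have "\<forall>\<^sub>F t in at_right 0. - (- r) * t\<^sup>2 \<le> primF f t"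
    by eventually_elim (simp add: field_simps)
  then show "\<exists>C. \<forall>\<^sub>F t in at_right 0. - C * t\<^sup>2 \<le> primF f t" by blast
  show "\<exists>\<^sub>F t in at_right 0. K * t\<^sup>2 < primF f t"
  proof (rule ccontr)
    assume "\<not> ?thesis"
    then have "\<forall>\<^sub>F t in at_right 0. primF f t \<le> K * t\<^sup>2"
      by (simp add: not_frequently not_less)
    with pos have "\<forall>\<^sub>F t in at_right 0. ereal (primF f t / t\<^sup>2) \<le> ereal K"
      by eventually_elim (simp add: field_simps)
    then have "Limsup (at_right 0) (\<lambda>t. ereal (primF f t / t\<^sup>2)) \<le> ereal K"
      by (rule Limsup_bounded)
    then show False using assms by (simp add: cond_f0_def)
  qed
  show "\<exists>\<^sub>F t in at_right 0. f t < 0"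
  proof (rule ccontr)
    assume "\<not> ?thesis"
    then have "\<forall>\<^sub>F t in at_right 0. 0 \<le> f t"
      by (simp add: not_frequently not_less)
    with pos have "\<forall>\<^sub>F t in at_right 0. 0 \<le> ereal (f t / t)"
      by eventually_elim simp
    then have "0 \<le> Liminf (at_right 0) (\<lambda>t. ereal (f t / t))"
      by (rule Liminf_bounded)
    then show False using assms unfolding cond_f0_def by (meson leD)
  qed
qed

lemma frequently_at_right_zeroD:
  assumes "\<exists>\<^sub>F t in at_right (0::real). P t" "0 < e"
  obtains t where "0 < t" "t < e" "P t"
proof -
  have "\<forall>\<^sub>F t in at_right 0. 0 < t \<and> t < e"
    using assms(2) by (auto simp: eventually_at_right_field)
  from frequently_eventually_conj[OF assms(1) this] that show thesis
    by (auto dest!: frequently_ex)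
qed

section \<open>Choice of the separated levels and construction of the solutions\<close>

theorem theorem1p2:
  fixes \<Omega> :: "(real^'n::finite) set" and s p :: real and f :: "real \<Rightarrow> real"
  assumes "CARD('n) \<ge> 2" and "0 < s" and "s < 1" and "real CARD('n) > 2 * s"
    and "bounded_smooth_domain \<Omega>"
    and "continuous_on {0..} f" and "f 0 = 0" and "cond_f0 f"
    and "0 < p" and "p < 1"
  shows "\<forall>k::nat. \<exists>lamk>0. \<forall>lam\<in>{-lamk..lamk}. \<exists>u :: nat \<Rightarrow> 'n rfun.
           (\<forall>i\<in>{1..k}. weak_solution s \<Omega> lam p f (u i)
              \<and> (AE x in lborel. u i x \<ge> 0)
              \<and> \<not> (AE x in lborel. u i x = 0)
              \<and> X0_norm s (u i) < 1 / real i
              \<and> Linf_norm \<Omega> (u i) < ereal (1 / real i)) \<and>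
           (\<forall>i\<in>{1..k}. \<forall>j\<in>{1..k}. i \<noteq> j \<longrightarrow> \<not> (AE x in lborel. u i x = u j x))"
proof
  fix k :: nat
  have \<Omega>: "open \<Omega>" "bounded \<Omega>" "\<Omega> \<noteq> {}"
    using assms(5) by (auto simp: bounded_smooth_domain_def)
  define G where "G lam b = primF (trunc_rhs lam p f b)" for lam b
  define V where "V = measure lborel \<Omega>"
  have V0: "0 \<le> V" by (simp add: V_def)
  obtain K where K: "\<And>t. 0 \<le> t \<Longrightarrow> t \<le> 1 \<Longrightarrow> \<bar>f t\<bar> \<le> K" and K0: "0 \<le> K"
  proof -
    have "compact (f ` {0..1})"
      using assms(6) by (intro compact_continuous_image) (auto intro: continuous_on_subset)
    then obtain B where B: "\<forall>y\<in>f ` {0..1}. \<bar>y\<bar> \<le> B"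
      by (metis bounded_iff compact_imp_bounded real_norm_def)
    then have B': "\<bar>f t\<bar> \<le> B" if "0 \<le> t" "t \<le> 1" for t using that by simp
    moreover have "0 \<le> B" using B'[of 0] by simp
    ultimately show thesis by (rule that)
  qed
  define A where "A = (1 + K) * V"
  have A0: "0 \<le> A" using K0 V0 by (simp add: A_def)
  note facts = assms(6,7,9)
  have Gc: "continuous_on UNIV (G lam b)" if "0 < b" for lam b
    unfolding G_def by (rule primF_trunc_rhs_continuous[OF facts less_imp_le[OF that]])
  have Gb: "\<bar>G lam b t\<bar> \<le> (1 + K) * \<bar>t\<bar>" if "0 < b" "b \<le> 1" "\<bar>lam\<bar> \<le> 1" for lam b t
    unfolding G_def by (rule primF_trunc_rhs_bound[OF facts less_imp_le[OF that(1)] K that(3,2)])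
  \<comment> \<open>The bound depends on the cap \<open>c\<close> of \<open>u\<close> and not on the
    truncation level \<open>b\<close>, so functions with different caps can be compared under one
    functional.\<close>
  have pot: "\<bar>LINT x:\<Omega>|lborel. G lam b (u x)\<bar> \<le> A * c"
    if "0 < b" "b \<le> 1" "\<bar>lam\<bar> \<le> 1" "u \<in> X0_between s \<Omega> c" for lam b c and u :: "'n rfun"
  proof -
    have "\<bar>G lam b t\<bar> \<le> (1 + K) * c" if "0 \<le> t" "t \<le> c" for t
    proof -
      have "\<bar>G lam b t\<bar> \<le> (1 + K) * \<bar>t\<bar>"
        by (rule Gb) (fact \<open>0 < b\<close> \<open>b \<le> 1\<close> \<open>\<bar>lam\<bar> \<le> 1\<close>)+
      also have "\<dots> \<le> (1 + K) * c" using that K0 by (intro mult_left_mono) auto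
      finally show ?thesis .
    qed
    from potential_bound[OF \<Omega>(1,2) Gc[OF that(1)] that(4) this]
    show ?thesis by (simp add: A_def V_def mult_ac)
  qed
  define e where "e b w = energy s \<Omega> (G 0 b) w" for b w
  \<comment> \<open>A candidate pairs a level \<open>b\<close> with a function of negative energy
    for \<open>lam = 0\<close>. The bound on \<open>2 * (A * b)\<close> later controls the norm of
    the minimizer.\<close>
  define P where "P n c \<longleftrightarrow> 0 < fst c \<and> fst c < 1 / (real n + 1)
      \<and> 2 * (A * fst c) < (1 / (real n + 1))\<^sup>2 \<and> f (fst c) < 0
      \<and> snd c \<in> X0_between s \<Omega> (fst c) \<and> e (fst c) (snd c) < 0" for n :: nat and c :: "real \<times> 'n rfun"
  have good: "\<exists>c. P n c \<and> fst c < \<epsilon> \<and> A * fst c < \<epsilon>" if "0 < \<epsilon>" for n \<epsilon>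
  proof -
    \<comment> \<open>One entry for each smallness requirement; \<open>A + 1\<close> avoids dividing
      by a possibly zero \<open>A\<close>.\<close>
    define \<eta> where "\<eta> = min (min \<epsilon> (1 / (real n + 1))) (min (\<epsilon> / (A + 1)) ((1 / (real n + 1))\<^sup>2 / (2 * (A + 1))))"
    have "0 < \<eta>" using that A0 by (simp add: \<eta>_def)
    then obtain b where b: "0 < b" "b < \<eta>" "f b < 0"
      using frequently_at_right_zeroD[OF cond_f0_dest(3)[OF assms(8)]] by blast
    have b1: "b < \<epsilon>" "b < 1 / (real n + 1)" using b by (auto simp: \<eta>_def)
    have "b < \<epsilon> / (A + 1)" using b by (simp add: \<eta>_def)
    then have Ab: "A * b < \<epsilon>" using A0 b by (simp add: field_simps)
    have "b < (1 / (real n + 1))\<^sup>2 / (2 * (A + 1))" using b by (simp add: \<eta>_def)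
    then have "2 * (A + 1) * b < (1 / (real n + 1))\<^sup>2"
      using A0 by (simp add: less_divide_eq mult.commute)
    then have Ab2: "2 * (A * b) < (1 / (real n + 1))\<^sup>2" using b by (simp add: algebra_simps)
    have G0: "G 0 b t = primF f t" if "t \<le> b" for t
      unfolding G_def by (rule primF_trunc_rhs_zero[OF facts less_imp_le[OF b(1)] that])
    have ev: "\<forall>\<^sub>F t in at_right 0. t \<le> b"
      using b(1) by (auto simp: eventually_at_right_field intro!: exI[of _ b])
    obtain C where "\<forall>\<^sub>F t in at_right 0. - C * t\<^sup>2 \<le> primF f t"
      using cond_f0_dest(1)[OF assms(8)] by blast
    with ev have low: "\<forall>\<^sub>F t in at_right 0. - C * t\<^sup>2 \<le> G 0 b t"
      by eventually_elim (simp add: G0)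
    have up: "\<exists>\<^sub>F t in at_right 0. K * t\<^sup>2 < G 0 b t" for K
      using frequently_eventually_conj[OF cond_f0_dest(2)[OF assms(8), of K] ev]
      by (rule frequently_elim1) (simp add: G0)
    obtain w where "w \<in> X0_between s \<Omega> b" "energy s \<Omega> (G 0 b) w < 0"
      by (rule exists_negative_energy[OF assms(2,3) \<Omega> Gc[OF b(1)] _ low up b(1)])
        (simp add: G_def primF_zero)
    then have "P n (b, w)" using b b1 Ab2 by (simp add: P_def e_def)
    then show ?thesis using b1 Ab by (intro exI[of _ "(b, w)"]) simp
  qed
  \<comment> \<open>Functions below the next level have energy above half the negative energy
    already reached; the other half is reserved for the perturbation by \<open>lam\<close>.\<close>
  have "\<exists>c. \<forall>n. P n (c n) \<and> fst (c (Suc n)) < fst (c n)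
      \<and> A * fst (c (Suc n)) < - e (fst (c n)) (snd (c n)) / 2"
  proof (rule dependent_nat_choice)
    show "\<exists>c. P 0 c" using good[of 1 0] by auto
    fix c n assume c: "P n c"
    define \<epsilon> where "\<epsilon> = min (fst c) (- e (fst c) (snd c) / 2)"
    have "0 < \<epsilon>" using c by (simp add: \<epsilon>_def P_def)
    from good[OF this, of "Suc n"]
    show "\<exists>d. P (Suc n) d \<and> fst d < fst c \<and> A * fst d < - e (fst c) (snd c) / 2"
      by (auto simp: \<epsilon>_def)
  qed
  then obtain c where c: "\<And>n. P n (c n)" "\<And>n. fst (c (Suc n)) < fst (c n)"
    "\<And>n. A * fst (c (Suc n)) < - e (fst (c n)) (snd (c n)) / 2" by blast
  define b where "b n = fst (c n)" for n
  define w where "w n = snd (c n)" for n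
  define E where "E n = - e (b n) (w n) / 2" for n
  have b: "0 < b n" "b n < 1 / (real n + 1)" "2 * (A * b n) < (1 / (real n + 1))\<^sup>2" "f (b n) < 0"
    and w: "w n \<in> X0_between s \<Omega> (b n)" and E: "0 < E n" for n
    using c(1)[of n] by (auto simp: P_def b_def w_def E_def)
  have b1: "b n \<le> 1" for n
  proof -
    have "1 / (real n + 1) \<le> 1" by simp
    then show ?thesis using b(2)[of n] by linarith
  qed
  have bE: "A * b m < E n" if "n < m" for m n
  proof -
    have "decseq b" using c(2) by (intro decseq_SucI) (simp add: b_def less_imp_le)
    then have "b m \<le> b (Suc n)" using that by (auto simp: decseq_def)
    then have "A * b m \<le> A * b (Suc n)" using A0 by (rule mult_left_mono)
    then show ?thesis using c(3)[of n] by (simp add: b_def w_def E_def)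
  qed
  \<comment> \<open>The entry \<open>1\<close> serves the bounds on the truncated nonlinearity,
    \<open>- f (b i)\<close> keeps the right-hand side nonpositive at \<open>b i\<close>, and
    \<open>E i / (V + 1)\<close> limits the energy shift to \<open>E i\<close>.\<close>
  define lamk where "lamk = Min (insert 1 ((\<lambda>i. min (- f (b i)) (E i / (V + 1))) ` {1..k}))"
  have lamk: "0 < lamk" "lamk \<le> 1" unfolding lamk_def using b(4) E V0 by auto
  have lamk': "lamk \<le> - f (b i)" "lamk \<le> E i / (V + 1)" if "i \<in> {1..k}" for i
  proof -
    have "lamk \<le> min (- f (b i)) (E i / (V + 1))"
      unfolding lamk_def using that by (intro Min_le) auto
    then show "lamk \<le> - f (b i)" "lamk \<le> E i / (V + 1)" by auto
  qed
  show "\<exists>lamk>0. \<forall>lam\<in>{-lamk..lamk}. \<exists>u :: nat \<Rightarrow> 'n rfun.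
           (\<forall>i\<in>{1..k}. weak_solution s \<Omega> lam p f (u i)
              \<and> (AE x in lborel. u i x \<ge> 0)
              \<and> \<not> (AE x in lborel. u i x = 0)
              \<and> X0_norm s (u i) < 1 / real i
              \<and> Linf_norm \<Omega> (u i) < ereal (1 / real i)) \<and>
           (\<forall>i\<in>{1..k}. \<forall>j\<in>{1..k}. i \<noteq> j \<longrightarrow> \<not> (AE x in lborel. u i x = u j x))"
  proof (intro exI[of _ lamk] conjI ballI lamk(1))
    fix lam assume "lam \<in> {- lamk..lamk}"
    then have lam: "\<bar>lam\<bar> \<le> lamk" by auto
    have lam1: "\<bar>lam\<bar> \<le> 1" using lam lamk by linarith
    have "\<exists>u. u \<in> X0_between s \<Omega> (b i) \<and>
        (\<forall>v \<in> X0_between s \<Omega> (b i). energy s \<Omega> (G lam (b i)) u \<le> energy s \<Omega> (G lam (b i)) v)" for i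
      by (rule energy_minimizer_exists[OF \<Omega>(1,2) Gc[OF b(1)] less_imp_le[OF b(1)]]) blast
    then obtain u where u: "\<And>i. u i \<in> X0_between s \<Omega> (b i)"
      and min: "\<And>i v. v \<in> X0_between s \<Omega> (b i) \<Longrightarrow> energy s \<Omega> (G lam (b i)) (u i) \<le> energy s \<Omega> (G lam (b i)) v"
      by metis
    have um: "u i \<in> borel_measurable lborel" for i using u[of i] by (simp add: X0_between_def X0_def)
    have ub: "0 \<le> u i x \<and> u i x \<le> b i" for i x using u[of i] by (simp add: X0_between_def)
    \<comment> \<open>For \<open>lam = 0\<close> the test function \<open>w i\<close> has energy
      \<open>- 2 * E i\<close>, of which the perturbation costs at most \<open>E i\<close>.\<close>
    have level: "energy s \<Omega> (G lam (b i)) (u i) \<le> - E i" if i: "i \<in> {1..k}" for i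
    proof -
      have "\<bar>G lam (b i) t - G 0 (b i) t\<bar> \<le> \<bar>lam\<bar>" if "0 \<le> t" "t \<le> b i" for t
      proof -
        have "\<bar>G lam (b i) t - G 0 (b i) t\<bar> \<le> \<bar>lam\<bar> * \<bar>t\<bar>"
          unfolding G_def by (rule primF_trunc_rhs_diff[OF facts less_imp_le[OF b(1)] b1])
        also have "\<dots> \<le> \<bar>lam\<bar> * 1" using that b1[of i] by (intro mult_left_mono) auto
        finally show ?thesis by simp
      qed
      from energy_perturbation[OF \<Omega>(1,2) Gc[OF b(1)] Gc[OF b(1)] w this]
      have "energy s \<Omega> (G lam (b i)) (w i) \<le> e (b i) (w i) + \<bar>lam\<bar> * V" by (simp add: e_def V_def)
      moreover have "\<bar>lam\<bar> * V \<le> E i"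
      proof -
        have "\<bar>lam\<bar> \<le> E i / (V + 1)" using lam lamk'(2)[OF i] by linarith
        then have "\<bar>lam\<bar> * (V + 1) \<le> E i" using V0 by (simp add: pos_le_divide_eq)
        then show ?thesis using abs_ge_zero[of lam] by (simp add: distrib_left)
      qed
      ultimately show ?thesis using min[OF w[of i]] by (simp add: E_def)
    qed
    \<comment> \<open>Under the functional of level \<open>i\<close>, any \<open>v\<close> with cap
      \<open>d\<close> has energy at least \<open>- (A * d)\<close>, strictly above that of
      \<open>u i\<close>. The case \<open>d = 0\<close> gives nontriviality, \<open>d = b j\<close>
      with \<open>i < j\<close> distinctness.\<close>
    have ne: "\<not> (AE x in lborel. u i x = v x)"
      if i: "i \<in> {1..k}" and v: "v \<in> X0_between s \<Omega> d" "A * d < E i" for i d v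
    proof
      assume ae: "AE x in lborel. u i x = v x"
      have "energy s \<Omega> (G lam (b i)) (u i) = energy s \<Omega> (G lam (b i)) v"
        using Gc[OF b(1)] \<Omega>(1) v um ae
        by (intro energy_cong_AE) (auto simp: X0_between_def X0_def borel_measurable_continuous_onI)
      moreover have "- (A * d) \<le> energy s \<Omega> (G lam (b i)) v"
      proof -
        have "0 \<le> (\<integral>z. gag s v v z \<partial>lborel2)" by (simp add: gag_self_nonneg)
        then show ?thesis
          using pot[OF b(1) b1 lam1 v(1), of i] unfolding energy_def by linarith
      qed
      ultimately show False using level[OF i] v(2) by linarith
    qed
    show "\<exists>u :: nat \<Rightarrow> 'n rfun.
           (\<forall>i\<in>{1..k}. weak_solution s \<Omega> lam p f (u i)
              \<and> (AE x in lborel. u i x \<ge> 0)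
              \<and> \<not> (AE x in lborel. u i x = 0)
              \<and> X0_norm s (u i) < 1 / real i
              \<and> Linf_norm \<Omega> (u i) < ereal (1 / real i)) \<and>
           (\<forall>i\<in>{1..k}. \<forall>j\<in>{1..k}. i \<noteq> j \<longrightarrow> \<not> (AE x in lborel. u i x = u j x))"
    proof (intro exI[of _ u] conjI ballI impI)
      fix i assume i: "i \<in> {1..k}"
      have inv: "1 / (real i + 1) < 1 / real i" using i by (simp add: field_simps)
      show "weak_solution s \<Omega> lam p f (u i)"
      proof (rule truncated_minimizer_weak_solution[OF facts less_imp_le[OF b(1)] \<Omega>(1,2) _ K lam1 b1 u])
        have "\<bar>lam * b i powr p\<bar> \<le> \<bar>lam\<bar> * 1"
          unfolding abs_mult using b(1)[of i] b1[of i] assms(9) by (intro mult_left_mono) (auto simp: powr_le1)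
        then show "lam * b i powr p + f (b i) \<le> 0" using lam lamk'(1)[OF i] by linarith
      qed (use min in \<open>auto simp: G_def\<close>)
      show "AE x in lborel. u i x \<ge> 0" using ub by simp
      have "((\<lambda>_. 0) :: 'n rfun) \<in> X0_between s \<Omega> 0" by (simp add: X0_between_def X0_zero)
      from ne[OF i this] show "\<not> (AE x in lborel. u i x = 0)" using E by simp
      show "X0_norm s (u i) < 1 / real i"
      proof -
        \<comment> \<open>The energy of \<open>u i\<close> is negative, so half its Gagliardo
          integral is below the potential term, which is at most \<open>A * b i\<close>.\<close>
        have "(\<integral>z. gag s (u i) (u i) z \<partial>lborel2) \<le> 2 * (A * b i)"
          using level[OF i] E[of i] pot[OF b(1) b1 lam1 u, of i i] unfolding energy_def by linarith
        also have "\<dots> < (1 / (real i + 1))\<^sup>2" by (rule b(3))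
        finally have "X0_norm s (u i) < sqrt ((1 / (real i + 1))\<^sup>2)"
          unfolding X0_norm_def by (rule real_sqrt_less_mono)
        also have "\<dots> = 1 / (real i + 1)" by simp
        finally show ?thesis using inv by linarith
      qed
      show "Linf_norm \<Omega> (u i) < ereal (1 / real i)"
      proof -
        have "Linf_norm \<Omega> (u i) \<le> ereal (b i)"
          unfolding Linf_norm_def
        proof (rule esssup_I)
          have [measurable]: "u i \<in> borel_measurable lborel" by (rule um)
          show "(\<lambda>x. ereal \<bar>u i x\<bar>) \<in> borel_measurable (restrict_space lborel \<Omega>)"
            by (intro measurable_restrict_space1) measurable
          show "AE x in restrict_space lborel \<Omega>. ereal \<bar>u i x\<bar> \<le> ereal (b i)" using ub by simp
        qed
        also have "\<dots> < ereal (1 / real i)" using b(2)[of i] inv by simp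
        finally show ?thesis .
      qed
    next
      fix i j assume ij: "i \<in> {1..k}" "j \<in> {1..k}" "i \<noteq> j"
      show "\<not> (AE x in lborel. u i x = u j x)"
      \<comment> \<open>The functional with the smaller index separates the two, as its minimum lies
        deeper than anything below the other cap.\<close>
      proof (cases "i < j")
        case True
        then show ?thesis using ne[OF ij(1) u bE] by blast
      next
        case False
        then have "\<not> (AE x in lborel. u j x = u i x)" using ne[OF ij(2) u bE, of i] ij(3) by simp
        then show ?thesis by (simp add: eq_commute)
      qed
    qed
  qed
qed

end
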